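(* Let $K$ be a field of characteristic zero, $B=K[x_1,\ldots,x_m]$ a standard graded polynomial ring, and $I=\langle f_1,\ldots,f_{n+1}\rangle$ a graded ideal of $B$ of linear type, minimally generated by the homogeneous elements $f_1,\ldots,f_{n+1}$ with $\deg f_j=d_j$, and with $\operatorname{grade}(I)=n$ (equivalently $\operatorname{ht}(I)=n$). Let $S=K[x_1,\ldots,x_m,y_1,\ldots,y_{n+1}]$ be bigraded by $\deg x_i=(1,0)$ and $\deg y_j=(d_j,1)$. Then the minimal (non-standard) bigraded free resolution of the Rees algebra $\mathcal R(I)$ over $S$ has the form $$\cdots\xrightarrow{\delta_4}\ \bigoplus_{j\ge 4}S(-j,-1)^{\beta_{4j}}\oplus C_2'\ \xrightarrow{\delta_3}\ \bigoplus_{j\ge 3}S(-j,-1)^{\beta_{3j}}\oplus C_1'\ \xrightarrow{\delta_2}\ \bigoplus_{j\ge 2}S(-j,-1)^{\beta_{2j}}\ \xrightarrow{\delta_1}\ S\to 0,$$ that is, for $i\ge 2$ the module in homological degree $i$ is $\bigoplus_{j}S(-j,-1)^{\beta_{i+1,j}}\oplus C_{i-1}'$, where $\beta_{ij}$ are the graded Betti numbers of $B/I$ over $B$, and for $i=1,\ldots,n-1$ $$C_i'=\bigoplus_{j=0}^{i-1}\ \bigoplus_{1\le j_1<j_2<\cdots<j_{i+2}\le n+1}S\bigl(-(d_{j_1}+d_{j_2}+\cdots+d_{j_{i+2}}),-j-2\bigr)$$ (with $C_i'=0$ for $i\geq n$) are the modules of the truncated Buchsbaum-Rim complex $\mathbb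 C'$ of the matrix $\begin{bmatrix} f_1&\cdots&f_{n+1}\\ y_1&\cdots&y_{n+1}\end{bmatrix}$, with differentials $\sigma_i$. Moreover, for $i=1,\ldots,\operatorname{proj\,dim}_S\mathcal R(I)$, the differentials are $$\delta_1=\begin{bmatrix}y_1&\cdots&y_{n+1}\end{bmatrix}\circ\phi_2',\qquad \delta_2=\begin{pmatrix}\phi_3'&\alpha_1\end{pmatrix},\qquad \delta_i=\begin{pmatrix}\phi_{i+1}'&\alpha_{i-1}\\ 0&-\sigma_{i-1}\end{pmatrix}\ (i\ge 3),$$ where block matrices are taken with respect to the displayed decompositions and the maps $\phi_i'$, $\sigma_i$, $\alpha_i$ are those described in the context.
   Context: The Rees algebra is $\mathcal R(I)=\bigoplus_{s\ge0}I^s t^s\subseteq B[t]$, an $S$-module via $y_j\mapsto f_jt$, bigraded by giving $bt^s$ ($b\in I^s$ homogeneous of degree $a$) bidegree $(a,s)$. $I$ is of linear type if the canonical map $\operatorname{Sym}(I)\to\mathcal R(I)$ is an isomorphism. $(\mathbb F,\phi)$ is the graded minimal free resolution of $B/I$: $F_0=B$, $F_1=\bigoplus_{j=1}^{n+1}B(-d_j)$ with basis $e_1,\ldots,e_{n+1}$, $\phi_1(e_j)=f_j$, and $F_i=\bigoplus_jB(-j)^{\beta_{ij}}$, $\phi_i:F_i\to F_{i-1}$. $\phi_i'$ denotes the base change of $\phi_i$ to $S$ and $F_i'=F_i\otimes_BS$, regarded for $i\ge2$ as $\bigoplus_jS(-j,-1)^{\beta_{ij}}$. Let $F$ be a free $S$-module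 with basis $e_1,\ldots,e_{n+1}$ and $G$ a free $S$-module with basis $g_1,g_2$. As a module $C_i'=\wedge^{i+2}F\otimes(\operatorname{Sym}_{i-1}G)^*$ for $1\le i\le n-1$, where $(\operatorname{Sym}_{i-1}G)^*$ has the divided-power basis $g_1^{*(a)}g_2^{*(b)}$, $a+b=i-1$. For $z=(z_1,\ldots,z_{n+1})\in S^{n+1}$ let $\partial_z(e_{j_1}\wedge\cdots\wedge e_{j_k})=\sum_{r=1}^k(-1)^{r-1}z_{j_r}\,e_{j_1}\wedge\cdots\wedge\widehat{e_{j_r}}\wedge\cdots\wedge e_{j_k}$. Put $f=(f_1,\ldots,f_{n+1})$, $y=(y_1,\ldots,y_{n+1})$. The Buchsbaum-Rim differentials $\sigma_i:C_i'\to C_{i-1}'$ ($2\le i\le n-1$) are $$\sigma_i\bigl(\gamma\otimes g_1^{*(a)}g_2^{*(b)}\bigr)=\partial_f\gamma\otimes g_1^{*(a-1)}g_2^{*(b)}+\partial_y\gamma\otimes g_1^{*(a)}g_2^{*(b-1)},$$ terms with a negative exponent being zero. Let $\nu$ be a map of complexes from the Koszul complex $(\wedge^{\bullet}B^{n+1},\partial_f)$ of $\phi_1$ to $(\mathbb F,\phi)$ extending the identity in degrees $0$ and $1$, and $\nu'$ its base change to $S$. The map of complexes $\alpha:\mathbb C'\to\mathbb F'$, where $\mathbb F'$ is the truncation $\cdots\to F_3'\to F_2'$, is given for $1\le i\le n-1$ by $\alpha_i:C_i'\to F_{i+1}'$, $$\alpha_i\bigl(\gamma\otimes g_1^{*(i-1)}\bigr)=(-1)^{i-1}\nu_{i+1}'(\partial_y\gamma),\qquad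 \alpha_i\bigl(\gamma\otimes g_1^{*(i-1-j)}g_2^{*(j)}\bigr)=0\ \text{ for } j\ge1.$$ It satisfies $\phi_{i+1}'\alpha_i=\alpha_{i-1}\sigma_i$. *)

theory Defs
  imports
    Complex_Main
    "HOL-Library.Cardinality"
    "HOL-Library.Poly_Mapping"
    "HOL-Library.Product_Plus"
    "HOL-Library.Extended_Nat"
    "HOL-Library.Set_Algebras"
    "HOL-Computational_Algebra.Polynomial"
begin

section \<open>Polynomial rings\<close>

text \<open>\<open>('v, 'a) mpoly\<close> is the polynomial ring over \<open>'a\<close> in variables indexed by \<open>'v\<close>.\<close>

type_synonym 'v mon = "'v \<Rightarrow>\<^sub>0 nat"
type_synonym ('v, 'a) mpoly = "'v mon \<Rightarrow>\<^sub>0 'a"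

definition Const :: "'a::comm_ring_1 \<Rightarrow> ('v, 'a) mpoly" where
  "Const a = Poly_Mapping.single 0 a"

definition Var :: "'v \<Rightarrow> ('v, 'a::comm_ring_1) mpoly" where
  "Var v = Poly_Mapping.single (Poly_Mapping.single v 1) 1"

definition eval_mpoly ::
  "('a::comm_ring_1 \<Rightarrow> 'r::comm_ring_1) \<Rightarrow> ('v \<Rightarrow> 'r) \<Rightarrow> ('v, 'a) mpoly \<Rightarrow> 'r" where
  "eval_mpoly c g p =
     (\<Sum>m\<in>Poly_Mapping.keys p. c (Poly_Mapping.lookup p m) *
        (\<Prod>v\<in>Poly_Mapping.keys m. g v ^ Poly_Mapping.lookup m v))"

text \<open>\<open>deg\<close> assigns a degree to every monomial; \<open>0\<close> is homogeneous of every degree.\<close>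

definition homogeneous :: "('v mon \<Rightarrow> 'g) \<Rightarrow> ('v, 'a::zero) mpoly \<Rightarrow> 'g \<Rightarrow> bool" where
  "homogeneous deg p g \<longleftrightarrow> (\<forall>m\<in>Poly_Mapping.keys p. deg m = g)"

definition std_deg :: "'x::finite mon \<Rightarrow> int" where
  "std_deg m = (\<Sum>v\<in>UNIV. int (Poly_Mapping.lookup m v))"

text \<open>
  With \<open>'x\<close> indexing the variables of \<open>B\<close> and \<open>'y\<close> indexing the generators of the ideal, the
  ring \<open>S\<close> is \<open>('x + 'y, 'k) mpoly\<close>: \<open>Var (Inl i)\<close> is \<open>x\<^sub>i\<close>, \<open>Var (Inr j)\<close> is \<open>y\<^sub>j\<close>.
\<close>

definition bideg :: "('y::finite \<Rightarrow> nat) \<Rightarrow> ('x::finite + 'y) mon \<Rightarrow> int \<times> int" where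
  "bideg d m =
     ((\<Sum>i\<in>UNIV. int (Poly_Mapping.lookup m (Inl i)))
        + (\<Sum>j\<in>UNIV. int (Poly_Mapping.lookup m (Inr j)) * int (d j)),
      \<Sum>j\<in>UNIV. int (Poly_Mapping.lookup m (Inr j)))"

definition to_S :: "('x, 'k::comm_ring_1) mpoly \<Rightarrow> ('x + 'y, 'k) mpoly" where
  "to_S = eval_mpoly Const (\<lambda>i. Var (Inl i))"

section \<open>Ideals, grade, linear type\<close>

abbreviation ideal :: "'r::comm_ring_1 set \<Rightarrow> 'r set" where
  "ideal \<equiv> module.span (*)"

fun ideal_pow :: "'r::comm_ring_1 set \<Rightarrow> nat \<Rightarrow> 'r set" where
  "ideal_pow I 0 = UNIV"
| "ideal_pow I (Suc s) = ideal {a * b | a b. a \<in> I \<and> b \<in> ideal_pow I s}"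

definition regular_sequence :: "'r::comm_ring_1 list \<Rightarrow> bool" where
  "regular_sequence rs \<longleftrightarrow>
     (\<forall>i<length rs. \<forall>a. rs ! i * a \<in> ideal (set (take i rs)) \<longrightarrow> a \<in> ideal (set (take i rs)))
     \<and> ideal (set rs) \<noteq> UNIV"

definition grade :: "'r::comm_ring_1 set \<Rightarrow> enat" where
  "grade I = (if I = UNIV then \<infinity>
     else Sup {enat (length rs) | rs. regular_sequence rs \<and> set rs \<subseteq> I})"

definition Rees :: "'r::comm_ring_1 set \<Rightarrow> 'r poly set" where
  "Rees I = {p. \<forall>s. coeff p s \<in> ideal_pow I s}"

text \<open>
  The symmetric algebra of the \<open>B\<close>-module \<open>I\<close> is \<open>B[X\<^sub>a | a \<in> I]\<close> modulo the ideal generated by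
  \<open>X\<^bsub>a+b\<^esub> - X\<^sub>a - X\<^sub>b\<close> and \<open>X\<^bsub>ra\<^esub> - r X\<^sub>a\<close>. The variable index type is \<open>B\<close> itself, so the
  polynomials are restricted to those involving only variables with index in \<open>I\<close>; elements of
  \<open>Sym I\<close> are cosets.
\<close>

definition Sym_free :: "'r::comm_ring_1 set \<Rightarrow> ('r, 'r) mpoly set" where
  "Sym_free I = {P. \<forall>m\<in>Poly_Mapping.keys P. Poly_Mapping.keys m \<subseteq> I}"

definition Sym_rels :: "'r::comm_ring_1 set \<Rightarrow> ('r, 'r) mpoly set" where
  "Sym_rels I = {Var (a + b) - Var a - Var b | a b. a \<in> I \<and> b \<in> I}
              \<union> {Var (r * a) - Const r * Var a | r a. a \<in> I}"

definition Sym_ideal :: "'r::comm_ring_1 set \<Rightarrow> ('r, 'r) mpoly set" where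
  "Sym_ideal I =
     {\<Sum>t\<in>T. c t * t | T c. finite T \<and> T \<subseteq> Sym_rels I \<and> c ` T \<subseteq> Sym_free I}"

definition Sym :: "'r::comm_ring_1 set \<Rightarrow> ('r, 'r) mpoly set set" where
  "Sym I = {P +o Sym_ideal I | P. P \<in> Sym_free I}"

text \<open>The canonical map is induced by \<open>X\<^sub>a \<mapsto> a t\<close>, which is constant on each coset.\<close>

definition Sym_to_Rees :: "('r::comm_ring_1, 'r) mpoly set \<Rightarrow> 'r poly" where
  "Sym_to_Rees X = the_elem (eval_mpoly (\<lambda>r. [:r:]) (\<lambda>a. monom a 1) ` X)"

definition linear_type :: "'r::comm_ring_1 set \<Rightarrow> bool" where
  "linear_type I \<longleftrightarrow> bij_betw Sym_to_Rees (Sym I) (Rees I)"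

section \<open>Graded free resolutions\<close>

text \<open>
  A complex of finite free modules is given by a basis in each homological degree, the degrees
  of the basis elements (a basis element of degree \<open>g\<close> spans a copy of \<open>R(-g)\<close>), and the
  matrices of the differentials: \<open>dmat C i r s\<close>, for \<open>i \<ge> 1\<close>, is the coefficient of
  \<open>r \<in> gens C (i - 1)\<close> in the image of \<open>s \<in> gens C i\<close>. Matrix entries outside these bases are
  irrelevant.
\<close>

record ('b, 'r, 'g) free_complex =
  gens :: "nat \<Rightarrow> 'b set"
  gdeg :: "nat \<Rightarrow> 'b \<Rightarrow> 'g"
  dmat :: "nat \<Rightarrow> 'b \<Rightarrow> 'b \<Rightarrow> 'r"

definition free_mod :: "'b set \<Rightarrow> ('b \<Rightarrow> 'r::zero) set" where
  "free_mod X = {v. \<forall>b. b \<notin> X \<longrightarrow> v b = 0}"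

definition differential ::
  "('b, 'r::comm_ring_1, 'g) free_complex \<Rightarrow> nat \<Rightarrow> ('b \<Rightarrow> 'r) \<Rightarrow> 'b \<Rightarrow> 'r" where
  "differential C i v =
     (\<lambda>r. if r \<in> gens C (i - 1) then \<Sum>s\<in>gens C i. dmat C i r s * v s else 0)"

text \<open>A graded module; its addition is that of the ambient type.\<close>

record ('r, 'm, 'g) graded_module =
  mcarrier :: "'m set"
  mscale :: "'r \<Rightarrow> 'm \<Rightarrow> 'm"
  mcomponent :: "'g \<Rightarrow> 'm set"

text \<open>
  \<open>\<cdots> \<rightarrow> C\<^sub>1 \<rightarrow> C\<^sub>0 \<rightarrow> M \<rightarrow> 0\<close> is a minimal graded free resolution with augmentation \<open>\<epsilon>\<close>, over the
  polynomial ring graded by \<open>deg\<close>. The kernel of \<open>\<epsilon>\<close> is expressed through equality of values, so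
  that \<open>M\<close> may consist of cosets. Minimality is \<open>d(C\<^sub>i) \<subseteq> \<mm> C\<^bsub>i-1\<^esub>\<close> with \<open>\<mm>\<close> generated by
  the variables.
\<close>

definition min_graded_free_resolution ::
  "('v mon \<Rightarrow> 'g::plus) \<Rightarrow> ('b, ('v, 'k::comm_ring_1) mpoly, 'g) free_complex
     \<Rightarrow> (('v, 'k) mpoly, 'm::plus, 'g) graded_module \<Rightarrow> (('b \<Rightarrow> ('v, 'k) mpoly) \<Rightarrow> 'm) \<Rightarrow> bool" where
  "min_graded_free_resolution deg C M \<epsilon> \<longleftrightarrow>
     (\<forall>i. finite (gens C i)) \<and>
     (\<forall>i. \<forall>r\<in>gens C i. \<forall>s\<in>gens C (Suc i). \<forall>m\<in>Poly_Mapping.keys (dmat C (Suc i) r s).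
        deg m + gdeg C i r = gdeg C (Suc i) s) \<and>
     (\<forall>i. {v \<in> free_mod (gens C (Suc i)). differential C (Suc i) v = (\<lambda>_. 0)}
        = differential C (Suc (Suc i)) ` free_mod (gens C (Suc (Suc i)))) \<and>
     (\<forall>v\<in>free_mod (gens C 0). \<forall>w\<in>free_mod (gens C 0). \<epsilon> (\<lambda>b. v b + w b) = \<epsilon> v + \<epsilon> w) \<and>
     (\<forall>r. \<forall>v\<in>free_mod (gens C 0). \<epsilon> (\<lambda>b. r * v b) = mscale M r (\<epsilon> v)) \<and>
     (\<forall>b\<in>gens C 0. \<epsilon> (\<lambda>b'. if b' = b then 1 else 0) \<in> mcomponent M (gdeg C 0 b)) \<and>
     \<epsilon> ` free_mod (gens C 0) = mcarrier M \<and>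
     (\<forall>v\<in>free_mod (gens C 0). \<forall>w\<in>free_mod (gens C 0).
        \<epsilon> v = \<epsilon> w \<longleftrightarrow> (\<lambda>b. v b - w b) \<in> differential C 1 ` free_mod (gens C 1)) \<and>
     (\<forall>i. \<forall>r\<in>gens C i. \<forall>s\<in>gens C (Suc i). dmat C (Suc i) r s \<in> ideal (range Var))"

text \<open>Graded Betti numbers of a module, read off from its minimal graded free resolution \<open>F\<close>.\<close>

definition betti :: "('b, 'r, 'g) free_complex \<Rightarrow> nat \<Rightarrow> 'g \<Rightarrow> nat" where
  "betti F i j = card {b \<in> gens F i. gdeg F i b = j}"

definition quotient_module ::
  "('x::finite, 'k::comm_ring_1) mpoly set \<Rightarrow>
     (('x, 'k) mpoly, ('x, 'k) mpoly set, int) graded_module" where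
  "quotient_module I =
     \<lparr> mcarrier = range (\<lambda>b. b +o I),
       mscale = (\<lambda>r X. (r *o X) + I),
       mcomponent = (\<lambda>g. {b +o I | b. homogeneous std_deg b g}) \<rparr>"

text \<open>\<open>S \<rightarrow> B[t]\<close>, \<open>x\<^sub>i \<mapsto> x\<^sub>i\<close>, \<open>y\<^sub>j \<mapsto> f\<^sub>j t\<close>.\<close>

definition rees_map ::
  "('y \<Rightarrow> ('x, 'k::comm_ring_1) mpoly) \<Rightarrow> ('x + 'y, 'k) mpoly \<Rightarrow> ('x, 'k) mpoly poly" where
  "rees_map f = eval_mpoly (\<lambda>c. [:Const c:])
     (\<lambda>z. case z of Inl i \<Rightarrow> [:Var i:] | Inr j \<Rightarrow> monom (f j) 1)"

definition rees_module ::
  "('y \<Rightarrow> ('x::finite, 'k::comm_ring_1) mpoly) \<Rightarrow>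
     (('x + 'y, 'k) mpoly, ('x, 'k) mpoly poly, int \<times> int) graded_module" where
  "rees_module f =
     (let I = ideal (range f) in
      \<lparr> mcarrier = Rees I,
        mscale = (\<lambda>r p. rees_map f r * p),
        mcomponent = (\<lambda>g. {monom b s | b s a.
           b \<in> ideal_pow I s \<and> homogeneous std_deg b a \<and> g = (a, int s)}) \<rparr>)"

section \<open>The Koszul complex and the comparison map\<close>

text \<open>
  Exterior powers of a free module with basis \<open>e\<^sub>j\<close>, \<open>j :: 'y\<close>, have as basis the finite subsets
  of \<open>'y\<close>, taken in increasing order; \<open>koszul z J' J\<close> is the coefficient of \<open>e\<^bsub>J'\<^esub>\<close> in
  \<open>\<partial>\<^sub>z e\<^sub>J\<close>.
\<close>

definition koszul ::
  "('y::linorder \<Rightarrow> 'r::comm_ring_1) \<Rightarrow> 'y set \<Rightarrow> 'y set \<Rightarrow> 'r" where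
  "koszul z J' J =
     (\<Sum>j\<in>J. if J' = J - {j} then (- 1) ^ card {k \<in> J. k < j} * z j else 0)"

text \<open>
  \<open>\<nu> i b J\<close> is the coefficient of the basis element \<open>b\<close> of \<open>F\<^sub>i\<close> in \<open>\<nu>\<^sub>i(e\<^sub>J)\<close>, \<open>card J = i\<close>;
  \<open>u\<close> is the basis element of \<open>F\<^sub>0\<close> and \<open>e j\<close> are those of \<open>F\<^sub>1\<close>. The map is graded, i.e.\ of
  degree \<open>0\<close>.
\<close>

definition koszul_comparison ::
  "('y::{finite,linorder} \<Rightarrow> ('x::finite, 'k::comm_ring_1) mpoly) \<Rightarrow> ('y \<Rightarrow> nat)
     \<Rightarrow> ('b, ('x, 'k) mpoly, int) free_complex \<Rightarrow> 'b \<Rightarrow> ('y \<Rightarrow> 'b)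
     \<Rightarrow> (nat \<Rightarrow> 'b \<Rightarrow> 'y set \<Rightarrow> ('x, 'k) mpoly) \<Rightarrow> bool" where
  "koszul_comparison f d F u e \<nu> \<longleftrightarrow>
     \<nu> 0 u {} = 1 \<and>
     (\<forall>j k. \<nu> 1 (e j) {k} = (if j = k then 1 else 0)) \<and>
     (\<forall>i. \<forall>r\<in>gens F i. \<forall>J. card J = Suc i \<longrightarrow>
        (\<Sum>s\<in>gens F (Suc i). dmat F (Suc i) r s * \<nu> (Suc i) s J)
          = (\<Sum>J' | card J' = i. \<nu> i r J' * koszul f J' J)) \<and>
     (\<forall>i. \<forall>r\<in>gens F i. \<forall>J. card J = i \<longrightarrow>
        (\<forall>m\<in>Poly_Mapping.keys (\<nu> i r J). std_deg m + gdeg F i r = (\<Sum>j\<in>J. int (d j))))"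

section \<open>The truncated Buchsbaum-Rim complex and the resolution\<close>

text \<open>
  The triple \<open>(J, a, b)\<close> stands for \<open>e\<^sub>J \<otimes> g\<^sub>1\<^bsup>*(a)\<^esup> g\<^sub>2\<^bsup>*(b)\<^esup>\<close>. The set \<open>br_gens i\<close> is the basis of
  \<open>C'\<^sub>i\<close>; it is empty for \<open>i = 0\<close> and, when \<open>'y\<close> has \<open>n + 1\<close> elements, for \<open>i \<ge> n\<close>.
\<close>

type_synonym 'y br_index = "'y set \<times> nat \<times> nat"

definition br_gens :: "nat \<Rightarrow> 'y::finite br_index set" where
  "br_gens i = {(J, a, b). card J = i + 2 \<and> a + b + 1 = i}"

definition br_deg :: "('y::finite \<Rightarrow> nat) \<Rightarrow> 'y br_index \<Rightarrow> int \<times> int" where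
  "br_deg d = (\<lambda>(J, a, b). (\<Sum>j\<in>J. int (d j), int b + 2))"

text \<open>The matrix of \<open>\<sigma>\<^sub>i\<close>, row index first; its entries do not depend on \<open>i\<close>.\<close>

definition br_sigma ::
  "('y::{finite,linorder} \<Rightarrow> ('x, 'k::comm_ring_1) mpoly) \<Rightarrow>
     'y br_index \<Rightarrow> 'y br_index \<Rightarrow> ('x + 'y, 'k) mpoly" where
  "br_sigma f = (\<lambda>(J', a', b') (J, a, b).
     (if a = a' + 1 \<and> b = b' then koszul (\<lambda>j. to_S (f j)) J' J else 0)
     + (if a = a' \<and> b = b' + 1 then koszul (\<lambda>j. Var (Inr j)) J' J else 0))"

text \<open>The matrix of \<open>\<alpha>\<^sub>i : C'\<^sub>i \<rightarrow> F'\<^bsub>i+1\<^esub>\<close> for \<open>i \<ge> 1\<close>.\<close>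

definition br_alpha ::
  "(nat \<Rightarrow> 'b \<Rightarrow> 'y set \<Rightarrow> ('x, 'k::comm_ring_1) mpoly) \<Rightarrow> nat \<Rightarrow>
     'b \<Rightarrow> 'y::{finite,linorder} br_index \<Rightarrow> ('x + 'y, 'k) mpoly" where
  "br_alpha \<nu> i r = (\<lambda>(J, a, b).
     if b = 0
     then (- 1) ^ (i - 1) *
       (\<Sum>J' | card J' = i + 1. to_S (\<nu> (i + 1) r J') * koszul (\<lambda>j. Var (Inr j)) J' J)
     else 0)"

datatype ('y, 'b) res_gen = One | FGen 'b | CGen "'y br_index"

text \<open>
  In degree \<open>0\<close> the module is \<open>S\<close>; in degree \<open>i \<ge> 1\<close> it is \<open>F'\<^bsub>i+1\<^esub> \<oplus> C'\<^bsub>i-1\<^esub>\<close>, where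
  \<open>C'\<^sub>0 = 0\<close>.
\<close>

definition res_gens :: "('b, 'r, int) free_complex \<Rightarrow> nat \<Rightarrow> ('y::finite, 'b) res_gen set" where
  "res_gens F i =
     (if i = 0 then {One} else FGen ` gens F (i + 1) \<union> CGen ` br_gens (i - 1))"

fun res_deg ::
  "('y::finite \<Rightarrow> nat) \<Rightarrow> ('b, 'r, int) free_complex \<Rightarrow> nat \<Rightarrow> ('y, 'b) res_gen \<Rightarrow> int \<times> int" where
  "res_deg d F i One = (0, 0)"
| "res_deg d F i (FGen s) = (gdeg F (i + 1) s, 1)"
| "res_deg d F i (CGen c) = br_deg d c"

definition res_delta ::
  "('y::{finite,linorder} \<Rightarrow> ('x, 'k::comm_ring_1) mpoly) \<Rightarrow>
     ('b, ('x, 'k) mpoly, int) free_complex \<Rightarrow> ('y \<Rightarrow> 'b) \<Rightarrow>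
     (nat \<Rightarrow> 'b \<Rightarrow> 'y set \<Rightarrow> ('x, 'k) mpoly) \<Rightarrow>
     nat \<Rightarrow> ('y, 'b) res_gen \<Rightarrow> ('y, 'b) res_gen \<Rightarrow> ('x + 'y, 'k) mpoly" where
  "res_delta f F e \<nu> i r s =
     (case (r, s) of
        (One, FGen s') \<Rightarrow> \<Sum>j\<in>UNIV. Var (Inr j) * to_S (dmat F 2 (e j) s')
      | (FGen r', FGen s') \<Rightarrow> to_S (dmat F (i + 1) r' s')
      | (FGen r', CGen c) \<Rightarrow> br_alpha \<nu> (i - 1) r' c
      | (CGen c', CGen c) \<Rightarrow> - br_sigma f c' c
      | _ \<Rightarrow> 0)"

definition rees_resolution ::
  "('y::{finite,linorder} \<Rightarrow> ('x, 'k::comm_ring_1) mpoly) \<Rightarrow> ('y \<Rightarrow> nat) \<Rightarrow>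
     ('b, ('x, 'k) mpoly, int) free_complex \<Rightarrow> ('y \<Rightarrow> 'b) \<Rightarrow>
     (nat \<Rightarrow> 'b \<Rightarrow> 'y set \<Rightarrow> ('x, 'k) mpoly) \<Rightarrow>
     (('y, 'b) res_gen, ('x + 'y, 'k) mpoly, int \<times> int) free_complex" where
  "rees_resolution f d F e \<nu> =
     \<lparr> gens = res_gens F, gdeg = res_deg d F, dmat = res_delta f F e \<nu> \<rparr>"

end

theory Submission imports Defs begin

text \<open>
  The complex of the theorem is the mapping cone of \<open>\<alpha> : C' \<rightarrow> F'\<close>, continued to \<open>S\<close> by
  \<open>y \<circ> \<phi>\<^sub>2'\<close>. Its exactness rests on two facts about Koszul complexes over \<open>S\<close>. The complex of
  \<open>\<partial>\<^sub>y\<close> is exact in positive degrees, because the \<open>y\<^sub>j\<close> form a regular sequence. The complex of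
  \<open>\<partial>\<^sub>f\<close> is exact in degrees at least \<open>2\<close>, because \<open>I\<close> contains a regular sequence of length \<open>n\<close>
  and has \<open>n + 1\<close> generators; this is depth sensitivity (\<open>koszul_exact\<close>) over \<open>B\<close>, carried over
  to the free \<open>B\<close>-module \<open>S\<close> (\<open>base_change_exact\<close>).

  From these two facts alone the Buchsbaum-Rim complex is seen to be exact. The key statement is
  \<open>kernel_double_koszul\<close>: a form \<open>\<gamma>\<close> of degree at least \<open>2\<close> with \<open>\<partial>\<^sub>y \<partial>\<^sub>f \<gamma> = 0\<close> lies in
  \<open>im \<partial>\<^sub>f + im \<partial>\<^sub>y\<close>. Indeed \<open>- \<partial>\<^sub>f \<gamma> = \<partial>\<^sub>y \<gamma>'\<close>, where \<open>\<gamma>'\<close> satisfies the same hypothesis and has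
  smaller degree in the \<open>y\<^sub>j\<close>. By induction \<open>\<gamma>' = \<partial>\<^sub>f \<eta> + \<partial>\<^sub>y \<theta>\<close>, so that \<open>\<gamma> - \<partial>\<^sub>y \<eta>\<close> is a cycle
  for \<open>\<partial>\<^sub>f\<close>, hence a boundary.

  A cycle of the cone has a component in \<open>C'\<close> and one in \<open>F'\<close>. The first is a cycle of the
  Buchsbaum-Rim complex, so after subtraction of a boundary only a cycle of \<open>F'\<close> remains, and
  \<open>F'\<close> is exact as a flat base change of \<open>F\<close> (\<open>lift_cycle\<close>). In the two lowest degrees the
  component in \<open>C'\<close> is absent or not constrained by \<open>\<sigma>\<close>; there \<open>\<phi>\<^sub>2'\<close> turns the condition on the
  component in \<open>F'\<close> into one on forms, since \<open>\<phi>\<^sub>2' \<alpha>\<^sub>1 = \<partial>\<^sub>f \<partial>\<^sub>y\<close>.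

  Linear type enters at the augmentation: it says that the kernel of \<open>S \<rightarrow> B[t]\<close> is generated by
  the forms \<open>\<Sum> w\<^sub>j y\<^sub>j\<close> with \<open>\<Sum> w\<^sub>j f\<^sub>j = 0\<close> (\<open>kernel_rees_map\<close>), and these generate the image of
  \<open>y \<circ> \<phi>\<^sub>2'\<close>. Degrees and minimality are read off the matrix entries. The bound on the shifts holds
  because each differential of a minimal resolution raises degrees by at least \<open>1\<close>.
\<close>

section \<open>Evaluation of polynomials\<close>

definition ring_hom :: "('a::comm_ring_1 \<Rightarrow> 'b::comm_ring_1) \<Rightarrow> bool" where
  "ring_hom h \<longleftrightarrow> h 1 = 1 \<and> (\<forall>a b. h (a + b) = h a + h b) \<and> (\<forall>a b. h (a * b) = h a * h b)"

lemma ring_homI: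
  assumes "h 1 = 1" "\<And>a b. h (a + b) = h a + h b" "\<And>a b. h (a * b) = h a * h b"
  shows "ring_hom h"
  using assms by (simp add: ring_hom_def)

lemma ring_hom_simps:
  assumes "ring_hom h"
  shows "h 1 = 1" "h 0 = 0" "h (a + b) = h a + h b" "h (a * b) = h a * h b"
    "h (- a) = - h a" "h (a - b) = h a - h b" "h (a ^ k) = h a ^ k"
    "h (sum t X) = (\<Sum>x\<in>X. h (t x))" "h (prod t X) = (\<Prod>x\<in>X. h (t x))"
proof -
  have one: "h 1 = 1" and add: "\<And>a b. h (a + b) = h a + h b" and mult: "\<And>a b. h (a * b) = h a * h b"
    using assms by (auto simp: ring_hom_def)
  have zero: "h 0 = 0" using add[of 0 0] by simp
  have minus: "h (- a) = - h a" for a using add[of a "- a"] zero by (simp add: eq_neg_iff_add_eq_0 add.commute)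
  show "h 1 = 1" "h 0 = 0" "h (a + b) = h a + h b" "h (a * b) = h a * h b" "h (- a) = - h a"
    by (fact one zero add mult minus)+
  show "h (a - b) = h a - h b" using add[of a "- b"] minus[of b] by simp
  show "h (a ^ k) = h a ^ k" by (induction k) (auto simp: one mult)
  show "h (sum t X) = (\<Sum>x\<in>X. h (t x))" by (induction X rule: infinite_finite_induct) (auto simp: zero add)
  show "h (prod t X) = (\<Prod>x\<in>X. h (t x))" by (induction X rule: infinite_finite_induct) (auto simp: one mult)
qed

lemma mpoly_sum_monomials:
  "p = (\<Sum>m\<in>Poly_Mapping.keys p. Poly_Mapping.single m (Poly_Mapping.lookup p m))"
  by (rule poly_mapping_eqI)
     (auto simp: lookup_sum lookup_single when_def not_in_keys_iff_lookup_eq_zero sum.delta')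

lemma mpoly_additive_induct [case_names single add]:
  fixes p :: "'m \<Rightarrow>\<^sub>0 'a::comm_monoid_add"
  assumes "\<And>m c. P (Poly_Mapping.single m c)" "\<And>p q. P p \<Longrightarrow> P q \<Longrightarrow> P (p + q)"
  shows "P p"
proof -
  have "P (\<Sum>m\<in>X. Poly_Mapping.single m (Poly_Mapping.lookup p m))" for X
    by (induction X rule: infinite_finite_induct) (use assms assms(1)[of undefined 0] in auto)
  then show ?thesis using mpoly_sum_monomials[of p] by metis
qed

definition mon_value :: "('v \<Rightarrow> 'r::comm_ring_1) \<Rightarrow> 'v mon \<Rightarrow> 'r" where
  "mon_value g m = (\<Prod>v\<in>Poly_Mapping.keys m. g v ^ Poly_Mapping.lookup m v)"

lemma mon_value_superset:
  assumes "finite X" "Poly_Mapping.keys m \<subseteq> X"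
  shows "mon_value g m = (\<Prod>v\<in>X. g v ^ Poly_Mapping.lookup m v)"
  unfolding mon_value_def using assms
  by (intro prod.mono_neutral_left) (auto simp: not_in_keys_iff_lookup_eq_zero)

lemma mon_value_zero [simp]: "mon_value g 0 = 1"
  by (simp add: mon_value_def)

lemma mon_value_single [simp]: "mon_value g (Poly_Mapping.single v k) = g v ^ k"
  by (simp add: mon_value_def)

lemma mon_value_add: "mon_value g (m + m') = mon_value g m * mon_value g m'"
proof -
  let ?X = "Poly_Mapping.keys m \<union> Poly_Mapping.keys m'"
  have "mon_value g (m + m') = (\<Prod>v\<in>?X. g v ^ Poly_Mapping.lookup (m + m') v)"
    by (rule mon_value_superset) (auto simp: keys_add)
  also have "\<dots> = (\<Prod>v\<in>?X. g v ^ Poly_Mapping.lookup m v) * (\<Prod>v\<in>?X. g v ^ Poly_Mapping.lookup m' v)"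
    by (simp add: lookup_add power_add prod.distrib)
  finally show ?thesis by (simp add: mon_value_superset[of ?X])
qed

lemma eval_mpoly_superset:
  assumes "c 0 = 0" "finite X" "Poly_Mapping.keys p \<subseteq> X"
  shows "eval_mpoly c g p = (\<Sum>m\<in>X. c (Poly_Mapping.lookup p m) * mon_value g m)"
  unfolding eval_mpoly_def mon_value_def[symmetric] using assms
  by (intro sum.mono_neutral_left) (auto simp: not_in_keys_iff_lookup_eq_zero)

lemma eval_mpoly_single:
  assumes "c 0 = 0"
  shows "eval_mpoly c g (Poly_Mapping.single m a) = c a * mon_value g m"
  using eval_mpoly_superset[of c "{m}" "Poly_Mapping.single m a" g] assms by simp

lemma eval_mpoly_add:
  assumes "ring_hom c"
  shows "eval_mpoly c g (p + q) = eval_mpoly c g p + eval_mpoly c g q"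
proof -
  let ?X = "Poly_Mapping.keys p \<union> Poly_Mapping.keys q"
  have "eval_mpoly c g (p + q) = (\<Sum>m\<in>?X. c (Poly_Mapping.lookup (p + q) m) * mon_value g m)"
    using assms by (intro eval_mpoly_superset) (auto simp: keys_add ring_hom_simps)
  also have "\<dots> = eval_mpoly c g p + eval_mpoly c g q"
    using assms
    by (simp add: eval_mpoly_superset[of c ?X] lookup_add ring_hom_simps distrib_right sum.distrib)
  finally show ?thesis .
qed

lemma eval_mpoly_mult:
  assumes c: "ring_hom c"
  shows "eval_mpoly c g (p * q) = eval_mpoly c g p * eval_mpoly c g q"
proof (induction p rule: mpoly_additive_induct)
  case (single m a)
  show ?case
  proof (induction q rule: mpoly_additive_induct)
    case (single m' b)
    show ?case using c
      by (simp add: mult_single eval_mpoly_single ring_hom_simps mon_value_add)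
  qed (use c in \<open>simp add: distrib_left eval_mpoly_add\<close>)
qed (use c in \<open>simp add: distrib_right eval_mpoly_add\<close>)

lemma eval_mpoly_Const:
  assumes "c 0 = 0"
  shows "eval_mpoly c g (Const a) = c a"
  using assms by (simp add: Const_def eval_mpoly_single)

lemma eval_mpoly_Var:
  assumes "c 0 = 0" "c 1 = 1"
  shows "eval_mpoly c g (Var v) = g v"
  using assms by (simp add: Var_def eval_mpoly_single)

lemma Const_1: "Const 1 = 1"
  by (simp add: Const_def)

lemma ring_hom_eval_mpoly:
  assumes "ring_hom c"
  shows "ring_hom (eval_mpoly c g)"
  using assms eval_mpoly_Const[of c g 1]
  by (intro ring_homI) (auto simp: ring_hom_simps eval_mpoly_add eval_mpoly_mult Const_1)

lemma eval_mpoly_cong: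
  assumes "\<And>a. c a = c' a" "\<And>m v. m \<in> Poly_Mapping.keys p \<Longrightarrow> v \<in> Poly_Mapping.keys m \<Longrightarrow> g v = g' v"
  shows "eval_mpoly c g p = eval_mpoly c' g' p"
  unfolding eval_mpoly_def by (intro sum.cong refl arg_cong2[of _ _ _ _ "(*)"] prod.cong) (auto simp: assms)

lemma eval_mpoly_compose:
  assumes "ring_hom h"
  shows "h (eval_mpoly c g p) = eval_mpoly (\<lambda>a. h (c a)) (\<lambda>v. h (g v)) p"
  using assms by (simp add: eval_mpoly_def ring_hom_simps)

lemma ring_hom_Const: "ring_hom Const"
  by (rule ring_homI) (simp_all add: Const_def single_add mult_single)

lemma Var_power: "Var v ^ k = Poly_Mapping.single (Poly_Mapping.single v k) 1"
  by (induction k) (simp_all add: Var_def mult_single flip: single_add)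

lemma mon_value_Var: "mon_value Var m = Poly_Mapping.single m 1"
proof (induction m rule: mpoly_additive_induct)
  case (single v k)
  then show ?case by (simp add: Var_power)
qed (simp add: mon_value_add mult_single)

lemma eval_mpoly_Const_Var: "eval_mpoly Const Var p = p"
proof (induction p rule: mpoly_additive_induct)
  case (single m a)
  then show ?case
    by (simp add: eval_mpoly_single ring_hom_simps[OF ring_hom_Const] mon_value_Var)
       (simp add: Const_def mult_single)
qed (simp add: eval_mpoly_add ring_hom_Const)

lemma ring_hom_to_S: "ring_hom (to_S :: ('x, 'k::comm_ring_1) mpoly \<Rightarrow> ('x + 'y, 'k) mpoly)"
  unfolding to_S_def by (intro ring_hom_eval_mpoly ring_hom_Const)

lemmas to_S_simps = ring_hom_simps[OF ring_hom_to_S]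

section \<open>Ideals\<close>

interpretation ideal: module "(*) :: 'r::comm_ring_1 \<Rightarrow> 'r \<Rightarrow> 'r"
  by unfold_locales (simp_all add: algebra_simps)

(* As a rewrite rule, this instance of the module law is associativity oriented against mult_ac,
   and simplification with both does not terminate. *)
declare ideal.scale_scale [simp del]

lemma ideal_mult_right: "a \<in> ideal X \<Longrightarrow> a * b \<in> ideal X"
  using ideal.span_scale[of a X b] by (simp add: mult.commute)

lemma ideal_range_finite:
  fixes g :: "'y::finite \<Rightarrow> 'r::comm_ring_1"
  assumes "a \<in> ideal (range g)"
  shows "\<exists>c. a = (\<Sum>j\<in>UNIV. c j * g j)"
  using assms
proof (induction rule: ideal.span_induct_alt)
  case base
  show ?case by (rule exI[of _ "\<lambda>_. 0"]) simp
next
  case (step c x y)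
  then obtain j b where "x = g j" "y = (\<Sum>j\<in>UNIV. b j * g j)" by auto
  then have "c * x + y = (\<Sum>k\<in>UNIV. ((if k = j then c else 0) + b k) * g k)"
    by (simp add: distrib_right sum.distrib if_distrib[of "\<lambda>t. t * _"] sum.delta' cong: if_cong)
  then show ?case by (intro exI[of _ "\<lambda>k. (if k = j then c else 0) + b k"])
qed

lemma lookup_Var_mult:
  "Poly_Mapping.lookup (Var v * s) m =
     (if Poly_Mapping.lookup m v = 0 then 0 else Poly_Mapping.lookup s (m - Poly_Mapping.single v 1))"
proof (induction s rule: mpoly_additive_induct)
  case (single m' a)
  have "Poly_Mapping.single v 1 + m' = m \<longleftrightarrow> 
      Poly_Mapping.lookup m v \<noteq> 0 \<and> m' = m - Poly_Mapping.single v 1"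
    by (auto simp: poly_mapping_eq_iff fun_eq_iff lookup_add lookup_minus lookup_single when_def
        split: if_splits)
  then show ?case by (auto simp: Var_def mult_single lookup_single when_def)
qed (simp add: distrib_left lookup_add)

lemma monomial_in_ideal_Var:
  assumes "Poly_Mapping.lookup m v \<noteq> 0" "v \<in> A"
  shows "Poly_Mapping.single m a \<in> ideal (Var ` A)"
proof -
  have "Poly_Mapping.single m a = Poly_Mapping.single (m - Poly_Mapping.single v 1) a * Var v"
  proof -
    have "m - Poly_Mapping.single v 1 + Poly_Mapping.single v 1 = m"
      using assms by (auto simp: poly_mapping_eq_iff fun_eq_iff lookup_add lookup_minus lookup_single when_def)
    then show ?thesis by (simp add: Var_def mult_single)
  qed
  moreover have "\<dots> \<in> ideal (Var ` A)"
    using assms by (intro ideal.span_scale ideal.span_base) simp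
  ultimately show ?thesis by simp
qed

text \<open>An ideal generated by variables is a monomial ideal, so membership is a condition on the
  monomials that occur.\<close>

lemma ideal_Var:
  "ideal (Var ` A) = {s :: ('v, 'k::comm_ring_1) mpoly.
     \<forall>m\<in>Poly_Mapping.keys s. \<exists>v\<in>A. Poly_Mapping.lookup m v \<noteq> 0}" (is "_ = ?M")
proof (intro equalityI subsetI)
  fix s assume "s \<in> ideal (Var ` A :: ('v, 'k) mpoly set)"
  then show "s \<in> ?M"
  proof (induction rule: ideal.span_induct_alt)
    case (step c x y)
    then obtain v where v: "x = Var v" "v \<in> A" by auto
    have "\<exists>v\<in>A. Poly_Mapping.lookup m v \<noteq> 0" if "m \<in> Poly_Mapping.keys (x * c)" for m
      using that v by (auto simp: in_keys_iff lookup_Var_mult split: if_splits)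
    then show ?case using step keys_add[of "c * x" y] by (auto simp: mult.commute)
  qed simp
next
  fix s assume "s \<in> ?M"
  then have "(\<Sum>m\<in>Poly_Mapping.keys s. Poly_Mapping.single m (Poly_Mapping.lookup s m)) \<in> ideal (Var ` A)"
    by (intro ideal.span_sum) (blast intro: monomial_in_ideal_Var)
  then show "s \<in> ideal (Var ` A)" using mpoly_sum_monomials[of s] by simp
qed

section \<open>Homogeneous polynomials\<close>

locale monomial_grading =
  fixes deg :: "'v mon \<Rightarrow> 'g::comm_monoid_add"
  assumes deg_0: "deg 0 = 0" and deg_add: "deg (m + m') = deg m + deg m'"
begin

lemma homogeneous_0: "homogeneous deg 0 a"
  by (simp add: homogeneous_def)

lemma homogeneous_add:
  "homogeneous deg p a \<Longrightarrow> homogeneous deg q a \<Longrightarrow> homogeneous deg (p + q) a"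
  using keys_add[of p q] by (auto simp: homogeneous_def)

lemma homogeneous_mult:
  "homogeneous deg p a \<Longrightarrow> homogeneous deg q b \<Longrightarrow> homogeneous deg (p * q) (a + b)"
  using keys_mult[of p q] by (fastforce simp: homogeneous_def deg_add)

lemma homogeneous_1: "homogeneous deg (1 :: ('v, 'k::comm_ring_1) mpoly) 0"
  by (auto simp: homogeneous_def deg_0)

lemma homogeneous_Const: "homogeneous deg (Const c) 0"
  by (auto simp: homogeneous_def deg_0 Const_def)

lemma homogeneous_sum:
  "(\<And>x. x \<in> X \<Longrightarrow> homogeneous deg (p x) a) \<Longrightarrow> homogeneous deg (sum p X) a"
  by (induction X rule: infinite_finite_induct) (auto intro: homogeneous_0 homogeneous_add)

lemma homogeneous_uminus:
  "homogeneous deg (p :: ('v, 'k::comm_ring_1) mpoly) a \<Longrightarrow> homogeneous deg (- p) a"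
  by (auto simp: homogeneous_def in_keys_iff)

lemma homogeneous_sign_mult:
  "homogeneous deg (p :: ('v, 'k::comm_ring_1) mpoly) a \<Longrightarrow> homogeneous deg ((- 1) ^ k * p) a"
  by (cases "even k") (auto intro: homogeneous_uminus)

lemma homogeneous_Var: "homogeneous deg (Var v) (deg (Poly_Mapping.single v 1))"
  by (auto simp: homogeneous_def Var_def)

end

interpretation std: monomial_grading std_deg
  by unfold_locales (simp_all add: std_deg_def lookup_add sum.distrib)

interpretation bi: monomial_grading "bideg d"
  by unfold_locales (simp_all add: bideg_def lookup_add sum.distrib distrib_right zero_prod_def)

lemma bideg_Var_Inr: "homogeneous (bideg d) (Var (Inr j)) (int (d j), 1)"
  using bi.homogeneous_Var[of d "Inr j"]
  by (simp add: bideg_def lookup_single when_def if_distrib[of "\<lambda>t. int t"] if_distrib[of "\<lambda>t. t * _"] sum.delta sum.delta' cong: if_cong)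

lemma to_S_single: "to_S (Poly_Mapping.single m a) = Const a * mon_value (\<lambda>i. Var (Inl i)) m"
  unfolding to_S_def by (rule eval_mpoly_single) (simp add: ring_hom_simps[OF ring_hom_Const])

lemma homogeneous_to_S:
  assumes "homogeneous std_deg p a"
  shows "homogeneous (bideg d) (to_S p) (a, 0)"
proof -
  have v: "homogeneous (bideg d) (Var (Inl i)) (1, 0)" for i
    using bi.homogeneous_Var[of d "Inl i"]
    by (simp add: bideg_def lookup_single when_def if_distrib[of "\<lambda>t. int t"] sum.delta sum.delta' cong: if_cong)
  have mv: "homogeneous (bideg d) (mon_value (\<lambda>i. Var (Inl i)) m) (std_deg m, 0)" for m
  proof (induction m rule: mpoly_additive_induct)
    case (single x k)
    have "homogeneous (bideg d) (Var (Inl x) ^ k) (int k, 0)"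
    proof (induction k)
      case 0
      then show ?case using bi.homogeneous_1[of d] by (simp add: zero_prod_def)
    next
      case (Suc k)
      from bi.homogeneous_mult[OF v this] show ?case by (simp add: add.commute)
    qed
    then show ?case by (simp add: std_deg_def lookup_single when_def if_distrib[of "\<lambda>t. int t"] sum.delta sum.delta' cong: if_cong)
  next
    case (add m m')
    from bi.homogeneous_mult[OF add] show ?case by (simp add: mon_value_add std.deg_add)
  qed
  have "to_S p = (\<Sum>m\<in>Poly_Mapping.keys p. Const (Poly_Mapping.lookup p m) * mon_value (\<lambda>i. Var (Inl i)) m)"
    by (simp add: to_S_def eval_mpoly_def mon_value_def)
  also have "homogeneous (bideg d) \<dots> (a, 0)"
  proof (rule bi.homogeneous_sum)
    fix m assume "m \<in> Poly_Mapping.keys p"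
    with assms have "std_deg m = a" by (simp add: homogeneous_def)
    then show "homogeneous (bideg d) (Const (Poly_Mapping.lookup p m) * mon_value (\<lambda>i. Var (Inl i)) m) (a, 0)"
      using bi.homogeneous_mult[OF bi.homogeneous_Const mv[of m]] by (simp add: zero_prod_def)
  qed
  finally show ?thesis .
qed

lemma to_S_in_ideal_Var:
  assumes "p \<in> ideal (range Var)"
  shows "to_S p \<in> ideal (range Var)"
  using assms
proof (induction rule: ideal.span_induct_alt)
  case (step c x y)
  then obtain i where "x = Var i" by auto
  then have "to_S x = Var (Inl i)"
    by (simp add: to_S_def eval_mpoly_Var ring_hom_simps[OF ring_hom_Const])
  then show ?case using step
    by (auto simp: to_S_simps intro!: ideal.span_add ideal.span_scale intro: ideal.span_base)
qed (simp add: to_S_simps ideal.span_zero)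

section \<open>The Koszul differential\<close>

text \<open>A form \<open>\<Sum> \<gamma>\<^sub>J e\<^sub>J\<close> is represented by its coefficient function \<open>J \<mapsto> \<gamma>\<^sub>J\<close>. Forms of all degrees
  share one type, and \<open>wedge k\<close> singles out those of degree \<open>k\<close>.\<close>

definition koszul_map ::
  "('y::{finite,linorder} \<Rightarrow> 'r::comm_ring_1) \<Rightarrow> ('y set \<Rightarrow> 'r) \<Rightarrow> 'y set \<Rightarrow> 'r" where
  "koszul_map z \<gamma> J' = (\<Sum>J\<in>UNIV. koszul z J' J * \<gamma> J)"

definition wedge :: "nat \<Rightarrow> ('y set \<Rightarrow> 'r::comm_ring_1) set" where
  "wedge k = {\<gamma>. \<forall>J. card J \<noteq> k \<longrightarrow> \<gamma> J = 0}"

definition wedge_sign :: "'y::{finite,linorder} set \<Rightarrow> 'y \<Rightarrow> 'r::comm_ring_1" where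
  "wedge_sign J j = (- 1) ^ card {k \<in> J. k < j}"

lemma wedge_sign_square: "wedge_sign J j * wedge_sign J j = 1"
  by (simp add: wedge_sign_def flip: power_mult_distrib)

lemma wedge_sign_insert_self: "wedge_sign (insert j J) j = wedge_sign J j"
proof -
  have "{k \<in> insert j J. k < j} = {k \<in> J. k < j}" by auto
  then show ?thesis by (simp add: wedge_sign_def)
qed

lemma wedge_sign_insert:
  assumes "j \<notin> J"
  shows "wedge_sign (insert j J) k = (if j < k then - wedge_sign J k else wedge_sign J k)"
proof -
  have "{l \<in> insert j J. l < k} = (if j < k then insert j {l \<in> J. l < k} else {l \<in> J. l < k})" by auto
  then show ?thesis using assms by (simp add: wedge_sign_def)
qed

lemma koszul_map_eq:
  "koszul_map z \<gamma> J' = (\<Sum>j\<in>- J'. wedge_sign J' j * z j * \<gamma> (insert j J'))"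
proof -
  have iff: "j \<in> J \<and> J' = J - {j} \<longleftrightarrow> j \<notin> J' \<and> J = insert j J'" for j J by auto
  have entry: "koszul z J' J * \<gamma> J =
      (\<Sum>j\<in>UNIV. if J = insert j J' then (if j \<notin> J' then wedge_sign J' j * z j * \<gamma> J else 0) else 0)" for J
  proof -
    have "koszul z J' J * \<gamma> J = (\<Sum>j\<in>J. if J' = J - {j} then wedge_sign J j * z j * \<gamma> J else 0)"
      unfolding koszul_def wedge_sign_def sum_distrib_right by (intro sum.cong) auto
    also have "\<dots> = (\<Sum>j\<in>UNIV. if j \<in> J \<and> J' = J - {j} then wedge_sign J j * z j * \<gamma> J else 0)"
      by (rule sum.mono_neutral_cong_left) auto
    also have "\<dots> = (\<Sum>j\<in>UNIV. if J = insert j J' then (if j \<notin> J' then wedge_sign J' j * z j * \<gamma> J else 0) else 0)"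
      unfolding iff by (intro sum.cong refl) (simp add: wedge_sign_insert_self)
    finally show ?thesis .
  qed
  have "koszul_map z \<gamma> J' =
      (\<Sum>j\<in>UNIV. \<Sum>J\<in>UNIV. if J = insert j J' then (if j \<notin> J' then wedge_sign J' j * z j * \<gamma> J else 0) else 0)"
    unfolding koszul_map_def entry by (rule sum.swap)
  also have "\<dots> = (\<Sum>j\<in>UNIV. if j \<notin> J' then wedge_sign J' j * z j * \<gamma> (insert j J') else 0)"
    by simp
  also have "\<dots> = (\<Sum>j\<in>- J'. wedge_sign J' j * z j * \<gamma> (insert j J'))"
    by (rule sum.mono_neutral_cong_right) auto
  finally show ?thesis .
qed

lemma koszul_map_add: "koszul_map z (\<lambda>J. \<gamma> J + \<delta> J) = (\<lambda>J. koszul_map z \<gamma> J + koszul_map z \<delta> J)"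
  by (simp add: koszul_map_def distrib_left sum.distrib fun_eq_iff)

lemma koszul_map_diff: "koszul_map z (\<lambda>J. \<gamma> J - \<delta> J) = (\<lambda>J. koszul_map z \<gamma> J - koszul_map z \<delta> J)"
  by (simp add: koszul_map_def right_diff_distrib sum_subtractf fun_eq_iff)

lemma koszul_map_uminus: "koszul_map z (\<lambda>J. - \<gamma> J) = (\<lambda>J. - koszul_map z \<gamma> J)"
  by (simp add: koszul_map_def sum_negf fun_eq_iff)

lemma koszul_map_0: "koszul_map z (\<lambda>J. 0) = (\<lambda>J. 0)"
  by (simp add: koszul_map_def fun_eq_iff)

lemma koszul_map_scale: "koszul_map z (\<lambda>J. c * \<gamma> J) = (\<lambda>J. c * koszul_map z \<gamma> J)"
  by (rule ext) (simp add: koszul_map_def sum_distrib_left mult.left_commute)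

lemmas koszul_map_linear =
  koszul_map_add koszul_map_diff koszul_map_uminus koszul_map_0 koszul_map_scale

lemma koszul_map_wedge: "\<gamma> \<in> wedge (Suc k) \<Longrightarrow> koszul_map z \<gamma> \<in> wedge k"
  unfolding wedge_def mem_Collect_eq koszul_map_eq by (intro allI impI sum.neutral ballI) simp

text \<open>The terms with \<open>j < k\<close> cancel those with \<open>k < j\<close>; no division by \<open>2\<close> is involved.\<close>

lemma sum_antisymmetric:
  fixes t :: "'y::linorder \<Rightarrow> 'y \<Rightarrow> 'r::ab_group_add"
  assumes "finite A" "\<And>j k. j \<in> A \<Longrightarrow> k \<in> A \<Longrightarrow> j \<noteq> k \<Longrightarrow> t j k = - t k j"
  shows "(\<Sum>j\<in>A. \<Sum>k\<in>A - {j}. t j k) = 0"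
proof -
  have "(\<Sum>k\<in>A - {j}. t j k) =
      (\<Sum>k\<in>A. if j < k then t j k else 0) + (\<Sum>k\<in>A. if k < j then t j k else 0)" for j
  proof -
    have "(\<Sum>k\<in>A - {j}. t j k) = (\<Sum>k\<in>A. (if j < k then t j k else 0) + (if k < j then t j k else 0))"
      using assms(1) by (intro sum.mono_neutral_cong_left) auto
    then show ?thesis by (simp add: sum.distrib)
  qed
  then have "(\<Sum>j\<in>A. \<Sum>k\<in>A - {j}. t j k) =
      (\<Sum>j\<in>A. \<Sum>k\<in>A. if j < k then t j k else 0) + (\<Sum>j\<in>A. \<Sum>k\<in>A. if k < j then t j k else 0)"
    by (simp add: sum.distrib)
  also have "(\<Sum>j\<in>A. \<Sum>k\<in>A. if k < j then t j k else 0) = (\<Sum>k\<in>A. \<Sum>j\<in>A. if k < j then t j k else 0)"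
    by (rule sum.swap)
  also have "\<dots> = (\<Sum>j\<in>A. \<Sum>k\<in>A. - (if j < k then t j k else 0))"
  proof (intro sum.cong refl)
    fix j k assume "j \<in> A" "k \<in> A"
    then show "(if j < k then t k j else 0) = - (if j < k then t j k else 0)"
      using assms(2)[of k j] by auto
  qed
  finally show ?thesis by (simp add: sum_negf)
qed

lemma koszul_map_square: "koszul_map z (koszul_map z \<gamma>) = (\<lambda>J. 0)"
proof
  fix J
  let ?t = "\<lambda>j k. wedge_sign J j * z j * (wedge_sign (insert j J) k * z k * \<gamma> (insert k (insert j J)))"
  have "koszul_map z (koszul_map z \<gamma>) J = (\<Sum>j\<in>- J. \<Sum>k\<in>- J - {j}. ?t j k)"
  proof -
    have "- insert j J = - J - {j}" for j by auto
    then show ?thesis by (simp add: koszul_map_eq sum_distrib_left)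
  qed
  also have "\<dots> = 0"
  proof (rule sum_antisymmetric)
    fix j k assume "j \<in> - J" "k \<in> - J" "j \<noteq> k"
    then show "?t j k = - ?t k j"
      by (cases "j < k") (auto simp: wedge_sign_insert insert_commute mult_ac)
  qed simp
  finally show "koszul_map z (koszul_map z \<gamma>) J = 0" .
qed

text \<open>The square of \<open>\<partial>\<^bsub>z+w\<^esub> = \<partial>\<^sub>z + \<partial>\<^sub>w\<close> vanishes, and its mixed part is the anticommutator.\<close>

lemma koszul_map_anticommute: "koszul_map z (koszul_map w \<gamma>) J = - koszul_map w (koszul_map z \<gamma>) J"
proof -
  have split: "koszul_map (\<lambda>j. z j + w j) \<delta> = (\<lambda>J. koszul_map z \<delta> J + koszul_map w \<delta> J)" for \<delta>
    by (simp add: koszul_map_eq fun_eq_iff algebra_simps sum.distrib)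
  have "koszul_map z (koszul_map w \<gamma>) J + koszul_map w (koszul_map z \<gamma>) J = 0"
    using fun_cong[OF koszul_map_square[of "\<lambda>j. z j + w j" \<gamma>], of J]
    by (simp add: split koszul_map_add koszul_map_square)
  then show ?thesis by (simp add: eq_neg_iff_add_eq_0)
qed

definition wedge_map ::
  "('y::{finite,linorder} \<Rightarrow> 'r::comm_ring_1) \<Rightarrow> ('y set \<Rightarrow> 'r) \<Rightarrow> 'y set \<Rightarrow> 'r" where
  "wedge_map c \<gamma> J = (\<Sum>j\<in>J. wedge_sign (J - {j}) j * c j * \<gamma> (J - {j}))"

lemma wedge_map_wedge:
  assumes "\<gamma> \<in> wedge k"
  shows "wedge_map c \<gamma> \<in> wedge (Suc k)"
proof -
  have "\<gamma> (J - {j}) = 0" if "card J \<noteq> Suc k" "j \<in> J" for J j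
    using that assms card_Suc_Diff1[of J j] by (auto simp: wedge_def)
  then show ?thesis by (simp add: wedge_def wedge_map_def)
qed

text \<open>Exterior multiplication by \<open>\<Sum> c\<^sub>j e\<^sub>j\<close> is a homotopy, so \<open>\<Sum> c\<^sub>j z\<^sub>j\<close> annihilates the homology.\<close>

lemma koszul_homotopy:
  fixes z c :: "'y::{finite,linorder} \<Rightarrow> 'r::comm_ring_1"
  shows "koszul_map z (wedge_map c \<gamma>) J + wedge_map c (koszul_map z \<gamma>) J = (\<Sum>j\<in>UNIV. c j * z j) * \<gamma> J"
proof -
  let ?s = wedge_sign
  let ?t = "\<lambda>j k. ?s (J - {k}) k * c k * (?s (J - {k}) j * z j * \<gamma> (insert j (J - {k})))"
  have sq: "?s A j * x * (?s A j * y * w) = x * y * w" for A j and x y w :: 'r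
  proof -
    have "?s A j * x * (?s A j * y * w) = (?s A j * ?s A j) * (x * y * w)" by (simp only: mult_ac)
    then show ?thesis by (simp add: wedge_sign_square)
  qed
  have "koszul_map z (wedge_map c \<gamma>) J = (\<Sum>j\<in>- J. c j * z j * \<gamma> J - (\<Sum>k\<in>J. ?t j k))"
    unfolding koszul_map_eq
  proof (intro sum.cong refl)
    fix j assume "j \<in> - J"
    then have j: "j \<notin> J" by simp
    have "wedge_map c \<gamma> (insert j J) =
        ?s J j * c j * \<gamma> J + (\<Sum>k\<in>J. ?s (insert j J - {k}) k * c k * \<gamma> (insert j J - {k}))"
      using j by (simp add: wedge_map_def)
    also have "(\<Sum>k\<in>J. ?s (insert j J - {k}) k * c k * \<gamma> (insert j J - {k})) =
        (\<Sum>k\<in>J. ?s (insert j (J - {k})) k * c k * \<gamma> (insert j (J - {k})))"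
    proof (intro sum.cong refl)
      fix k assume "k \<in> J"
      with j have "insert j J - {k} = insert j (J - {k})" by auto
      then show "?s (insert j J - {k}) k * c k * \<gamma> (insert j J - {k}) =
        ?s (insert j (J - {k})) k * c k * \<gamma> (insert j (J - {k}))" by simp
    qed
    finally have expand: "wedge_map c \<gamma> (insert j J) = ?s J j * c j * \<gamma> J +
        (\<Sum>k\<in>J. ?s (insert j (J - {k})) k * c k * \<gamma> (insert j (J - {k})))" .
    have "?s J j * z j * wedge_map c \<gamma> (insert j J) =
      c j * z j * \<gamma> J + (\<Sum>k\<in>J. ?s J j * z j * (?s (insert j (J - {k})) k * c k * \<gamma> (insert j (J - {k}))))"
      unfolding expand distrib_left sum_distrib_left sq by (simp add: mult.commute[of "z j" "c j"])
    also have "(\<Sum>k\<in>J. ?s J j * z j * (?s (insert j (J - {k})) k * c k * \<gamma> (insert j (J - {k})))) = 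
      (\<Sum>k\<in>J. - ?t j k)"
    proof (intro sum.cong refl)
      fix k assume k: "k \<in> J"
      have sgn: "(?s J j :: 'r) = (if k < j then - ?s (J - {k}) j else ?s (J - {k}) j)"
        using wedge_sign_insert[of k "J - {k}" j, where 'b = 'r] k by (simp add: insert_absorb)
      have "j \<noteq> k" "j \<notin> J - {k}" using j k by auto
      then show "?s J j * z j * (?s (insert j (J - {k})) k * c k * \<gamma> (insert j (J - {k}))) = - ?t j k"
        unfolding sgn wedge_sign_insert[OF \<open>j \<notin> J - {k}\<close>] by (cases "j < k") (simp_all add: mult_ac)
    qed
    finally show "?s J j * z j * wedge_map c \<gamma> (insert j J) = c j * z j * \<gamma> J - (\<Sum>k\<in>J. ?t j k)"
      by (simp add: sum_negf)
  qed
  moreover have "wedge_map c (koszul_map z \<gamma>) J = (\<Sum>k\<in>J. c k * z k * \<gamma> J + (\<Sum>j\<in>- J. ?t j k))"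
    unfolding wedge_map_def
  proof (intro sum.cong refl)
    fix k assume k: "k \<in> J"
    then have "- (J - {k}) = insert k (- J)" "insert k (J - {k}) = J" by auto
    with k show "?s (J - {k}) k * c k * koszul_map z \<gamma> (J - {k}) = c k * z k * \<gamma> J + (\<Sum>j\<in>- J. ?t j k)"
      by (simp add: koszul_map_eq distrib_left sum_distrib_left sq)
  qed
  moreover have "(\<Sum>j\<in>- J. \<Sum>k\<in>J. ?t j k) = (\<Sum>k\<in>J. \<Sum>j\<in>- J. ?t j k)" by (rule sum.swap)
  moreover have "(\<Sum>j\<in>UNIV. c j * z j) * \<gamma> J = (\<Sum>j\<in>- J. c j * z j * \<gamma> J) + (\<Sum>j\<in>J. c j * z j * \<gamma> J)"
    unfolding sum_distrib_right
    by (subst sum.union_disjoint[symmetric]) (auto simp: Un_commute Compl_partition)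
  ultimately show ?thesis by (simp add: sum_subtractf sum.distrib)
qed

lemma koszul_map_singletons: "koszul_map z \<gamma> {} = (\<Sum>j\<in>UNIV. z j * \<gamma> {j})"
  by (simp add: koszul_map_eq wedge_sign_def)

section \<open>Depth sensitivity of the Koszul complex\<close>

definition weakly_regular :: "'r::comm_ring_1 list \<Rightarrow> bool" where
  "weakly_regular rs \<longleftrightarrow>
     (\<forall>i<length rs. \<forall>a. rs ! i * a \<in> ideal (set (take i rs)) \<longrightarrow> a \<in> ideal (set (take i rs)))"

text \<open>Descending induction on the number \<open>k\<close> of elements divided out, with \<open>\<J>\<^sub>k\<close> the ideal they
  generate. Write the next element as \<open>a = \<Sum> c\<^sub>j f\<^sub>j\<close>, and let \<open>h\<close> be the homotopy for \<open>c\<close>. If \<open>\<gamma>\<close> is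
  a cycle modulo \<open>\<J>\<^sub>k\<close>, then \<open>a \<gamma> = \<partial>\<^sub>f h(\<gamma>)\<close> modulo \<open>\<J>\<^sub>k\<close>, so \<open>h(\<gamma>)\<close> is a cycle modulo
  \<open>\<J>\<^bsub>k+1\<^esub> = \<J>\<^sub>k + (a)\<close>. It is of degree one higher, hence a boundary there: \<open>h(\<gamma>) = \<partial>\<^sub>f \<eta> + a \<theta>\<close>
  modulo \<open>\<J>\<^sub>k\<close>. Applying \<open>\<partial>\<^sub>f\<close> gives \<open>a \<gamma> = a \<partial>\<^sub>f \<theta>\<close> modulo \<open>\<J>\<^sub>k\<close>, and \<open>a\<close> can be cancelled. When
  all elements are divided out, the degree exceeds the number of generators and \<open>\<gamma> = 0\<close>.\<close>

lemma koszul_exact_mod: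
  fixes f :: "'y::{finite,linorder} \<Rightarrow> 'r::comm_ring_1"
  assumes reg: "weakly_regular rs" and sub: "set rs \<subseteq> ideal (range f)"
    and "k \<le> length rs" "CARD('y) + k < i + length rs" "\<gamma> \<in> wedge i"
    and "\<And>J. koszul_map f \<gamma> J \<in> ideal (set (take k rs))"
  shows "\<exists>\<eta>\<in>wedge (Suc i). \<forall>J. \<gamma> J - koszul_map f \<eta> J \<in> ideal (set (take k rs))"
  using assms(3-)
proof (induction k arbitrary: i \<gamma> rule: inc_induct)
  case base
  have "\<gamma> J = 0" for J
  proof -
    have "card J \<le> CARD('y)" by (simp add: card_mono)
    then show ?thesis using base by (auto simp: wedge_def)
  qed
  moreover have "(\<lambda>J. 0) \<in> wedge (Suc i)" by (simp add: wedge_def)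
  ultimately show ?case by (auto simp: koszul_map_0 ideal.span_zero intro!: bexI[of _ "\<lambda>J. 0"])
next
  case (step k)
  let ?S = "set (take k rs)" and ?a = "rs ! k"
  have insert: "set (take (Suc k) rs) = insert ?a ?S"
    using step.hyps by (simp add: take_Suc_conv_app_nth)
  have "?a \<in> ideal (range f)" using sub step.hyps by auto
  then obtain c where c: "?a = (\<Sum>j\<in>UNIV. c j * f j)" using ideal_range_finite by blast
  define h where "h = wedge_map c \<gamma>"
  define w where "w = wedge_map c (koszul_map f \<gamma>)"
  have h: "h \<in> wedge (Suc i)" unfolding h_def by (rule wedge_map_wedge) fact
  have w: "w J \<in> ideal ?S" for J
    unfolding w_def wedge_map_def by (intro ideal.span_sum ideal.span_scale step.prems)
  have kh: "koszul_map f h J = ?a * \<gamma> J - w J" for J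
    using koszul_homotopy[of f c \<gamma> J] by (simp add: c h_def w_def algebra_simps)
  have "koszul_map f h J \<in> ideal (set (take (Suc k) rs))" for J
  proof -
    have "w J \<in> ideal (insert ?a ?S)" using w ideal.span_mono[of ?S "insert ?a ?S"] by auto
    moreover have "?a * \<gamma> J \<in> ideal (insert ?a ?S)" by (intro ideal_mult_right ideal.span_base) simp
    ultimately show ?thesis unfolding kh insert by (rule ideal.span_diff[rotated])
  qed
  from step.IH[OF _ h this] step.prems obtain \<eta> where
    \<eta>: "\<eta> \<in> wedge (Suc (Suc i))" "\<And>J. h J - koszul_map f \<eta> J \<in> ideal (insert ?a ?S)"
    unfolding insert by auto
  from \<eta>(2) have "\<forall>J. \<exists>t. h J - koszul_map f \<eta> J - t * ?a \<in> ideal ?S"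
    by (simp add: ideal.span_breakdown_eq)
  then obtain t where t: "\<And>J. h J - koszul_map f \<eta> J - t J * ?a \<in> ideal ?S" by metis
  (* The cut-off makes theta homogeneous; in other degrees there is nothing to correct. *)
  define \<theta> where "\<theta> J = (if card J = Suc i then t J else 0)" for J
  have \<theta>: "\<theta> \<in> wedge (Suc i)" by (simp add: \<theta>_def wedge_def)
  define r where "r J = h J - koszul_map f \<eta> J - ?a * \<theta> J" for J
  have r: "r J \<in> ideal ?S" for J
  proof (cases "card J = Suc i")
    case True
    then show ?thesis using t[of J] by (simp add: r_def \<theta>_def mult.commute)
  next
    case False
    then show ?thesis using h koszul_map_wedge[OF \<eta>(1), of f]
      by (simp add: r_def \<theta>_def wedge_def ideal.span_zero)
  qed
  have "\<gamma> J - koszul_map f \<theta> J \<in> ideal ?S" for J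
  proof -
    have "koszul_map f r J = koszul_map f h J - ?a * koszul_map f \<theta> J"
      unfolding r_def by (simp add: koszul_map_diff koszul_map_scale koszul_map_square)
    then have "?a * (\<gamma> J - koszul_map f \<theta> J) = koszul_map f r J + w J"
      by (simp add: kh algebra_simps)
    moreover have "koszul_map f r J + w J \<in> ideal ?S"
      unfolding koszul_map_def by (intro ideal.span_add ideal.span_sum ideal.span_scale w r)
    ultimately show ?thesis using reg step.hyps unfolding weakly_regular_def by metis
  qed
  then show ?case using \<theta> by blast
qed

lemma koszul_exact:
  fixes f :: "'y::{finite,linorder} \<Rightarrow> 'r::comm_ring_1"
  assumes "weakly_regular rs" "set rs \<subseteq> ideal (range f)" "CARD('y) < i + length rs"
    and "\<gamma> \<in> wedge i" "koszul_map f \<gamma> = (\<lambda>J. 0)"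
  shows "\<exists>\<eta>\<in>wedge (Suc i). \<gamma> = koszul_map f \<eta>"
  using koszul_exact_mod[of rs f 0 i \<gamma>] assms by (auto simp: fun_eq_iff)

section \<open>Flat base change\<close>

lemma Const_0 [simp]: "Const 0 = 0"
  by (simp add: Const_def)

declare Const_1 [simp]

lemma to_S_Const [simp]: "to_S (Const a) = Const a"
  by (simp add: to_S_def eval_mpoly_Const ring_hom_simps[OF ring_hom_Const])

lemma to_S_Var [simp]: "to_S (Var i) = Var (Inl i)"
  by (simp add: to_S_def eval_mpoly_Var ring_hom_simps[OF ring_hom_Const])

text \<open>The isomorphism \<open>S \<cong> B[y]\<close> and its inverse give access to the coefficients in \<open>B\<close> of an
  element of \<open>S\<close>.\<close>

definition S_to_iterated :: "('x + 'y, 'k::comm_ring_1) mpoly \<Rightarrow> ('y, ('x, 'k) mpoly) mpoly" where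
  "S_to_iterated = eval_mpoly (\<lambda>c. Const (Const c)) (case_sum (\<lambda>i. Const (Var i)) Var)"

definition iterated_to_S :: "('y, ('x, 'k::comm_ring_1) mpoly) mpoly \<Rightarrow> ('x + 'y, 'k) mpoly" where
  "iterated_to_S = eval_mpoly to_S (\<lambda>j. Var (Inr j))"

lemma ring_hom_Const_Const: "ring_hom (\<lambda>c. Const (Const c))"
  by (rule ring_homI) (simp_all add: ring_hom_simps[OF ring_hom_Const])

lemma ring_hom_S_to_iterated: "ring_hom S_to_iterated"
  unfolding S_to_iterated_def by (intro ring_hom_eval_mpoly ring_hom_Const_Const)

lemma ring_hom_iterated_to_S: "ring_hom iterated_to_S"
  unfolding iterated_to_S_def by (intro ring_hom_eval_mpoly ring_hom_to_S)

lemma iterated_to_S_S_to_iterated: "iterated_to_S (S_to_iterated s) = s"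
proof -
  have "iterated_to_S (S_to_iterated s) = eval_mpoly Const Var s"
    unfolding S_to_iterated_def eval_mpoly_compose[OF ring_hom_iterated_to_S]
    by (intro eval_mpoly_cong)
       (auto simp: iterated_to_S_def eval_mpoly_Const eval_mpoly_Var to_S_simps split: sum.split)
  then show ?thesis by (simp add: eval_mpoly_Const_Var)
qed

lemma S_to_iterated_to_S: "S_to_iterated (to_S b) = Const b"
proof -

  have "S_to_iterated (to_S b) = eval_mpoly (\<lambda>a. Const (Const a)) (\<lambda>i. Const (Var i)) b"
    unfolding to_S_def eval_mpoly_compose[OF ring_hom_S_to_iterated]
    by (intro eval_mpoly_cong) (auto simp: S_to_iterated_def eval_mpoly_Const eval_mpoly_Var)
  also have "\<dots> = Const (eval_mpoly Const Var b)"
    by (rule eval_mpoly_compose[OF ring_hom_Const, symmetric])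
  finally show ?thesis by (simp add: eval_mpoly_Const_Var)
qed

lemma lookup_Const_mult: "Poly_Mapping.lookup (Const b * p) m = b * Poly_Mapping.lookup p m"
  by (induction p rule: mpoly_additive_induct)
     (auto simp: Const_def mult_single lookup_single when_def distrib_left lookup_add)

text \<open>\<open>S\<close> is free over \<open>B\<close> on the monomials in the \<open>y\<^sub>j\<close>. A matrix over \<open>B\<close> acts on each coefficient
  of a vector over \<open>S\<close> separately, so exactness can be checked coefficient by coefficient.\<close>

lemma base_change_exact:
  fixes M :: "'p \<Rightarrow> 'q \<Rightarrow> ('x, 'k::comm_ring_1) mpoly" and N :: "'q \<Rightarrow> 't \<Rightarrow> ('x, 'k) mpoly"
    and V :: "'q \<Rightarrow> ('x + 'y, 'k) mpoly"
  assumes fin: "finite Q"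
    and exact: "\<And>v. (\<And>p. p \<in> P \<Longrightarrow> (\<Sum>q\<in>Q. M p q * v q) = 0) \<Longrightarrow> \<exists>w. \<forall>q\<in>Q. v q = (\<Sum>t\<in>T. N q t * w t)"
    and V: "\<And>p. p \<in> P \<Longrightarrow> (\<Sum>q\<in>Q. to_S (M p q) * V q) = 0"
  shows "\<exists>W. \<forall>q\<in>Q. V q = (\<Sum>t\<in>T. to_S (N q t) * W t)"
proof -
  define c where "c \<mu> q = Poly_Mapping.lookup (S_to_iterated (V q)) \<mu>" for \<mu> q
  have "\<exists>w. \<forall>q\<in>Q. c \<mu> q = (\<Sum>t\<in>T. N q t * w t)" for \<mu>
  proof (rule exact)
    fix p assume "p \<in> P"
    then have "Poly_Mapping.lookup (S_to_iterated (\<Sum>q\<in>Q. to_S (M p q) * V q)) \<mu> = 0"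
      using V by (simp add: ring_hom_simps[OF ring_hom_S_to_iterated])
    then show "(\<Sum>q\<in>Q. M p q * c \<mu> q) = 0"
      by (simp add: ring_hom_simps[OF ring_hom_S_to_iterated] S_to_iterated_to_S lookup_sum
          lookup_Const_mult c_def)
  qed
  then obtain w where w: "\<And>\<mu> q. q \<in> Q \<Longrightarrow> c \<mu> q = (\<Sum>t\<in>T. N q t * w \<mu> t)" by metis
  define U where "U = (\<Union>q\<in>Q. Poly_Mapping.keys (S_to_iterated (V q)))"
  have U: "finite U" unfolding U_def using fin by auto
  define W where "W t = (\<Sum>\<mu>\<in>U. to_S (w \<mu> t) * mon_value (\<lambda>j. Var (Inr j)) \<mu>)" for t
  have "V q = (\<Sum>t\<in>T. to_S (N q t) * W t)" if q: "q \<in> Q" for q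
  proof -
    have "V q = iterated_to_S (S_to_iterated (V q))" by (simp add: iterated_to_S_S_to_iterated)
    also have "\<dots> = (\<Sum>\<mu>\<in>U. to_S (c \<mu> q) * mon_value (\<lambda>j. Var (Inr j)) \<mu>)"
      unfolding iterated_to_S_def c_def using q U
      by (intro eval_mpoly_superset) (auto simp: to_S_simps U_def)
    also have "\<dots> = (\<Sum>\<mu>\<in>U. \<Sum>t\<in>T. to_S (N q t) * (to_S (w \<mu> t) * mon_value (\<lambda>j. Var (Inr j)) \<mu>))"
      by (simp add: w[OF q] to_S_simps sum_distrib_right mult.assoc)
    also have "\<dots> = (\<Sum>t\<in>T. to_S (N q t) * W t)"
      unfolding W_def sum_distrib_left by (rule sum.swap)
    finally show ?thesis .
  qed
  then show ?thesis by blast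
qed

section \<open>Truncation in the second degree\<close>

definition ydeg :: "('x + 'y::finite) mon \<Rightarrow> nat" where
  "ydeg m = (\<Sum>j\<in>UNIV. Poly_Mapping.lookup m (Inr j))"

interpretation ydeg: monomial_grading ydeg
  by unfold_locales (simp_all add: ydeg_def lookup_add sum.distrib)

definition trunc :: "nat \<Rightarrow> ('x + 'y::finite, 'k::comm_ring_1) mpoly \<Rightarrow> ('x + 'y, 'k) mpoly" where
  "trunc c s = (\<Sum>m\<in>{m \<in> Poly_Mapping.keys s. ydeg m < c}. Poly_Mapping.single m (Poly_Mapping.lookup s m))"

lemma lookup_trunc:
  "Poly_Mapping.lookup (trunc c s) m = (if ydeg m < c then Poly_Mapping.lookup s m else 0)"
  unfolding trunc_def
  by (auto simp: lookup_sum lookup_single when_def not_in_keys_iff_lookup_eq_zero sum.delta')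

lemma trunc_0: "trunc 0 s = 0"
  by (simp add: trunc_def)

lemma trunc_zero: "trunc c 0 = 0"
  by (simp add: trunc_def)

lemma trunc_add: "trunc c (s + t) = trunc c s + trunc c t"
  by (rule poly_mapping_eqI) (simp add: lookup_trunc lookup_add)

lemma trunc_uminus: "trunc c (- s) = - trunc c s"
  by (rule poly_mapping_eqI) (simp add: lookup_trunc)

lemma trunc_sum: "trunc c (sum t X) = (\<Sum>x\<in>X. trunc c (t x))"
  by (induction X rule: infinite_finite_induct) (simp_all add: trunc_zero trunc_add)

lemma trunc_trunc: "trunc c (trunc c s) = trunc c s"
  by (rule poly_mapping_eqI) (simp add: lookup_trunc)

lemma trunc_homogeneous_mult:
  assumes "homogeneous ydeg p e"
  shows "trunc (e + c) (p * s) = p * trunc c s"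
proof -
  have single: "trunc (e + c) (Poly_Mapping.single m a * s) = Poly_Mapping.single m a * trunc c s"
    if "ydeg m = e" for m a
  proof (induction s rule: mpoly_additive_induct)
    case (single m' b)
    have t: "trunc c (Poly_Mapping.single m b) = (if ydeg m < c then Poly_Mapping.single m b else 0)"
      for c m and b :: 'c
      by (rule poly_mapping_eqI) (auto simp: lookup_trunc lookup_single when_def)
    show ?case using that by (simp add: mult_single t ydeg.deg_add)
  qed (simp add: distrib_left trunc_add)
  have "trunc (e + c) ((\<Sum>m\<in>Poly_Mapping.keys p. Poly_Mapping.single m (Poly_Mapping.lookup p m)) * s) =
      (\<Sum>m\<in>Poly_Mapping.keys p. Poly_Mapping.single m (Poly_Mapping.lookup p m)) * trunc c s"
    using assms by (simp add: sum_distrib_right trunc_sum single homogeneous_def)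
  then show ?thesis using mpoly_sum_monomials[of p] by simp
qed

lemma eventually_trunc:
  fixes s :: "'i::finite \<Rightarrow> ('x + 'y::finite, 'k::comm_ring_1) mpoly"
  shows "\<exists>c. \<forall>i. trunc c (s i) = s i"
proof (intro exI allI)
  fix i
  let ?D = "\<Union>i. ydeg ` Poly_Mapping.keys (s i)"
  have "ydeg m < Suc (Max ?D)" if "m \<in> Poly_Mapping.keys (s i)" for m
    using that by (intro le_imp_less_Suc Max_ge) auto
  then show "trunc (Suc (Max ?D)) (s i) = s i"
    by (intro poly_mapping_eqI) (auto simp: lookup_trunc in_keys_iff)
qed

lemma ydeg_Var_Inr: "homogeneous ydeg (Var (Inr j)) 1"
  using ydeg.homogeneous_Var[of "Inr j"] by (simp add: ydeg_def lookup_single when_def)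

lemma ydeg_to_S: "homogeneous ydeg (to_S p) 0"
proof (induction p rule: mpoly_additive_induct)
  case (single m a)
  have "homogeneous ydeg (mon_value (\<lambda>i. Var (Inl i)) m) 0"
  proof (induction m rule: mpoly_additive_induct)
    case (single x k)
    show ?case
      by (auto simp: Var_power homogeneous_def ydeg_def lookup_single)
  next
    case (add m m')
    from ydeg.homogeneous_mult[OF add] show ?case by (simp add: mon_value_add)
  qed
  from ydeg.homogeneous_mult[OF ydeg.homogeneous_Const this] show ?case
    by (simp add: to_S_single)
qed (simp add: to_S_simps ydeg.homogeneous_add)

lemma trunc_koszul_map:
  assumes "\<And>j. homogeneous ydeg (z j) e"
  shows "trunc (e + c) (koszul_map z \<gamma> J) = koszul_map z (\<lambda>J. trunc c (\<gamma> J)) J"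
proof -
  have "homogeneous ydeg (wedge_sign J j * z j) e" for j
    unfolding wedge_sign_def by (rule ydeg.homogeneous_sign_mult) fact
  then show ?thesis
    by (simp only: koszul_map_eq trunc_sum trunc_homogeneous_mult)
qed

section \<open>The two Koszul complexes over \<open>S\<close>\<close>

abbreviation koszul_y ::
  "('y::{finite,linorder} set \<Rightarrow> ('x + 'y, 'k::comm_ring_1) mpoly) \<Rightarrow> 'y set \<Rightarrow> ('x + 'y, 'k) mpoly" where
  "koszul_y \<equiv> koszul_map (\<lambda>j. Var (Inr j))"

abbreviation koszul_f ::
  "('y::{finite,linorder} \<Rightarrow> ('x, 'k::comm_ring_1) mpoly) \<Rightarrow>
    ('y set \<Rightarrow> ('x + 'y, 'k) mpoly) \<Rightarrow> 'y set \<Rightarrow> ('x + 'y, 'k) mpoly" where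
  "koszul_f f \<equiv> koszul_map (\<lambda>j. to_S (f j))"

lemma weakly_regular_variables:
  assumes "distinct vs"
  shows "weakly_regular (map Var vs :: ('v, 'k::comm_ring_1) mpoly list)"
  unfolding weakly_regular_def
proof (intro allI impI)
  fix i and a :: "('v, 'k) mpoly"
  assume i: "i < length (map Var vs :: ('v, 'k) mpoly list)"
    and mem: "map Var vs ! i * a \<in> ideal (set (take i (map Var vs)))"
  let ?A = "set (take i vs)"
  have v: "vs ! i \<notin> ?A" using assms i by (auto simp: in_set_conv_nth nth_eq_iff_index_eq)
  have A: "set (take i (map Var vs)) = (Var ` ?A :: ('v, 'k) mpoly set)" by (simp add: take_map)
  show "a \<in> ideal (set (take i (map Var vs)))" unfolding A ideal_Var
  proof (intro CollectI ballI)
    fix m assume "m \<in> Poly_Mapping.keys a"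
    then have "m + Poly_Mapping.single (vs ! i) 1 \<in> Poly_Mapping.keys (Var (vs ! i) * a)"
      by (simp add: in_keys_iff lookup_Var_mult lookup_add)
    then obtain w where "w \<in> ?A" "Poly_Mapping.lookup (m + Poly_Mapping.single (vs ! i) 1) w \<noteq> 0"
      using mem i unfolding A ideal_Var by auto
    then show "\<exists>v\<in>?A. Poly_Mapping.lookup m v \<noteq> 0"
      using v by (intro bexI[of _ w]) (auto simp: lookup_add lookup_single when_def split: if_splits)
  qed
qed

lemma koszul_y_exact:
  fixes \<gamma> :: "'y::{finite,linorder} set \<Rightarrow> ('x + 'y, 'k::comm_ring_1) mpoly"
  assumes "0 < k" "\<gamma> \<in> wedge k" "koszul_y \<gamma> = (\<lambda>J. 0)"
  shows "\<exists>\<eta>\<in>wedge (Suc k). \<gamma> = koszul_y \<eta>"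
proof -
  define vs :: "('x + 'y) list" where "vs = map Inr (sorted_list_of_set UNIV)"
  have "weakly_regular (map Var vs :: ('x + 'y, 'k) mpoly list)"
    by (rule weakly_regular_variables) (simp add: vs_def distinct_map)
  then show ?thesis
    by (rule koszul_exact) (use assms in \<open>auto simp: vs_def intro: ideal.span_base\<close>)
qed

text \<open>As \<open>\<partial>\<^sub>y\<close> raises the degree in the \<open>y\<^sub>j\<close> by exactly one, a preimage can be truncated to smaller
  degree. This makes the induction in \<open>kernel_double_koszul\<close> possible.\<close>

lemma koszul_y_exact_trunc:
  assumes "0 < k" "\<gamma> \<in> wedge k" "koszul_y \<gamma> = (\<lambda>J. 0)" "\<And>J. trunc (Suc c) (\<gamma> J) = \<gamma> J"
  shows "\<exists>\<eta>\<in>wedge (Suc k). \<gamma> = koszul_y \<eta> \<and> (\<forall>J. trunc c (\<eta> J) = \<eta> J)"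
proof -
  obtain \<eta> where \<eta>: "\<eta> \<in> wedge (Suc k)" "\<gamma> = koszul_y \<eta>"
    using koszul_y_exact[OF assms(1-3)] by auto
  have "(\<lambda>J. trunc c (\<eta> J)) \<in> wedge (Suc k)" using \<eta>(1) by (simp add: wedge_def trunc_zero)
  moreover have "\<gamma> = koszul_y (\<lambda>J. trunc c (\<eta> J))"
    using trunc_koszul_map[OF ydeg_Var_Inr, where c = c and \<gamma> = \<eta>] \<eta>(2) assms(4) by auto
  ultimately show ?thesis by (intro bexI[of _ "\<lambda>J. trunc c (\<eta> J)"]) (auto simp: trunc_trunc)
qed

lemma koszul_map_on_wedge:
  assumes "\<gamma> \<in> wedge k"
  shows "koszul_map z \<gamma> J' = (\<Sum>J | card J = k. koszul z J' J * \<gamma> J)"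
  unfolding koszul_map_def using assms by (intro sum.mono_neutral_right) (auto simp: wedge_def)

lemma to_S_koszul: "to_S (koszul f J' J) = koszul (\<lambda>j. to_S (f j)) J' J"
  by (simp add: koszul_def to_S_simps if_distrib[of to_S] cong: if_cong)

lemma koszul_yfy: "koszul_y (koszul_f f (koszul_y \<gamma>)) J = 0"
  by (subst koszul_map_anticommute) (simp add: koszul_map_square koszul_map_0)

text \<open>Depth sensitivity gives exactness over \<open>B\<close>, and base change carries it to \<open>S\<close>.\<close>

lemma koszul_f_exact:
  fixes f :: "'y::{finite,linorder} \<Rightarrow> ('x, 'k::comm_ring_1) mpoly"
  assumes reg: "weakly_regular rs" "set rs \<subseteq> ideal (range f)" "CARD('y) < Suc k + length rs"
    and \<gamma>: "\<gamma> \<in> wedge (Suc k)" "koszul_f f \<gamma> = (\<lambda>J. 0)"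
  shows "\<exists>\<eta>\<in>wedge (Suc (Suc k)). \<gamma> = koszul_f f \<eta>"
proof -
  let ?Q = "{J :: 'y set. card J = Suc k}" and ?T = "{J :: 'y set. card J = Suc (Suc k)}"
  have "\<exists>W. \<forall>J\<in>?Q. \<gamma> J = (\<Sum>J'\<in>?T. to_S (koszul f J J') * W J')"
  proof (rule base_change_exact)
    fix v :: "'y set \<Rightarrow> ('x, 'k) mpoly"
    assume v: "\<And>J'. J' \<in> {J'. card J' = k} \<Longrightarrow> (\<Sum>J\<in>?Q. koszul f J' J * v J) = 0"
    define \<gamma> where "\<gamma> J = (if card J = Suc k then v J else 0)" for J
    have w: "\<gamma> \<in> wedge (Suc k)" by (simp add: \<gamma>_def wedge_def)
    have "koszul_map f \<gamma> J' = 0" for J'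
    proof (cases "card J' = k")
      case True
      then show ?thesis using v[of J'] by (simp add: koszul_map_on_wedge[OF w]) (simp add: \<gamma>_def)
    next
      case False
      then show ?thesis using koszul_map_wedge[OF w, of f] by (simp add: wedge_def)
    qed
    then obtain \<eta> where \<eta>: "\<eta> \<in> wedge (Suc (Suc k))" "\<gamma> = koszul_map f \<eta>"
      using koszul_exact[OF reg w] by auto
    have "v J = (\<Sum>J'\<in>?T. koszul f J J' * \<eta> J')" if "J \<in> ?Q" for J
      using that fun_cong[OF \<eta>(2), of J] by (simp add: koszul_map_on_wedge[OF \<eta>(1)] \<gamma>_def)
    then show "\<exists>w. \<forall>J\<in>?Q. v J = (\<Sum>J'\<in>?T. koszul f J J' * w J')" by blast
  next
    fix J' :: "'y set"
    show "(\<Sum>J\<in>?Q. to_S (koszul f J' J) * \<gamma> J) = 0"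
      using fun_cong[OF \<gamma>(2), of J'] by (simp add: koszul_map_on_wedge[OF \<gamma>(1)] to_S_koszul)
  qed simp
  then obtain W where W: "\<And>J. card J = Suc k \<Longrightarrow> \<gamma> J = (\<Sum>J'\<in>?T. to_S (koszul f J J') * W J')"
    by auto
  define \<eta> where "\<eta> J = (if card J = Suc (Suc k) then W J else 0)" for J
  have \<eta>: "\<eta> \<in> wedge (Suc (Suc k))" by (simp add: \<eta>_def wedge_def)
  have "\<gamma> J = koszul_f f \<eta> J" for J
  proof (cases "card J = Suc k")
    case True
    then show ?thesis
      by (simp add: W koszul_map_on_wedge[OF \<eta>] to_S_koszul) (simp add: \<eta>_def)
  next
    case False
    then show ?thesis using koszul_map_wedge[OF \<eta>, of "\<lambda>j. to_S (f j)"] \<gamma>(1) by (simp add: wedge_def)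
  qed
  then show ?thesis using \<eta> by blast
qed

section \<open>Exactness of the Buchsbaum-Rim complex\<close>

text \<open>Degree \<open>1\<close> is left out because the first Koszul homology of \<open>n + 1\<close> generators of a proper ideal
  of grade \<open>n\<close> does not vanish.\<close>

locale buchsbaum_rim =
  fixes f :: "'y::{finite,linorder} \<Rightarrow> ('x, 'k::comm_ring_1) mpoly"
  assumes exact_f: "\<And>k \<gamma>. \<gamma> \<in> wedge (Suc (Suc k)) \<Longrightarrow> koszul_f f \<gamma> = (\<lambda>J. 0) \<Longrightarrow>
      \<exists>\<eta>\<in>wedge (Suc (Suc (Suc k))). \<gamma> = koszul_f f \<eta>"
begin

text \<open>Induction on a strict bound \<open>c\<close> for the degree in the \<open>y\<^sub>j\<close>: the form \<open>- \<partial>\<^sub>f \<gamma>\<close> is a cycle for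
  \<open>\<partial>\<^sub>y\<close>, hence \<open>\<partial>\<^sub>y \<gamma>'\<close> with \<open>\<gamma>'\<close> below the bound \<open>c - 1\<close>, and
  \<open>\<partial>\<^sub>y \<partial>\<^sub>f \<gamma>' = - \<partial>\<^sub>f \<partial>\<^sub>y \<gamma>' = \<partial>\<^sub>f \<partial>\<^sub>f \<gamma> = 0\<close>. From \<open>\<gamma>' = \<partial>\<^sub>f \<eta> + \<partial>\<^sub>y \<theta>\<close> it follows that
  \<open>\<partial>\<^sub>f (\<gamma> - \<partial>\<^sub>y \<eta>) = 0\<close>, and exactness for \<open>\<partial>\<^sub>f\<close> concludes.\<close>

lemma kernel_double_koszul:
  assumes "\<gamma> \<in> wedge (Suc (Suc k))" "koszul_y (koszul_f f \<gamma>) = (\<lambda>J. 0)"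
  shows "\<exists>\<eta>\<in>wedge (Suc (Suc (Suc k))). \<exists>\<theta>\<in>wedge (Suc (Suc (Suc k))).
    \<gamma> = (\<lambda>J. koszul_f f \<eta> J + koszul_y \<theta> J)"
proof -
  have "\<exists>\<eta>\<in>wedge (Suc (Suc (Suc k))). \<exists>\<theta>\<in>wedge (Suc (Suc (Suc k))).
      \<gamma> = (\<lambda>J. koszul_f f \<eta> J + koszul_y \<theta> J)"
    if "\<And>J. trunc c (\<gamma> J) = \<gamma> J" for c
    using assms that
  proof (induction c arbitrary: \<gamma>)
    case 0
    then have "\<gamma> = (\<lambda>J. 0)" by (auto simp: trunc_0)
    then show ?case
      by (intro bexI[of _ "\<lambda>J. 0"]) (simp_all add: koszul_map_0 wedge_def)
  next
    case (Suc c)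
    have neg: "(\<lambda>J. - koszul_f f \<gamma> J) \<in> wedge (Suc k)"
      using koszul_map_wedge[OF Suc.prems(1), of "\<lambda>j. to_S (f j)"] by (simp add: wedge_def)
    have tr: "trunc (Suc c) (koszul_f f \<gamma> J) = koszul_f f \<gamma> J" for J
      using trunc_koszul_map[OF ydeg_to_S, where c = "Suc c" and \<gamma> = \<gamma>] Suc.prems(3) by simp
    obtain \<gamma>' where \<gamma>': "\<gamma>' \<in> wedge (Suc (Suc k))" "(\<lambda>J. - koszul_f f \<gamma> J) = koszul_y \<gamma>'"
        "\<And>J. trunc c (\<gamma>' J) = \<gamma>' J"
      using koszul_y_exact_trunc[OF _ neg, of c] tr Suc.prems(2)
      by (auto simp: koszul_map_uminus trunc_uminus)
    have "koszul_y (koszul_f f \<gamma>') = (\<lambda>J. 0)"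
      by (rule ext, subst koszul_map_anticommute)
         (simp add: koszul_map_uminus koszul_map_square flip: \<gamma>'(2))
    from Suc.IH[OF \<gamma>'(1) this \<gamma>'(3)] obtain \<eta> \<theta>
      where \<eta>: "\<eta> \<in> wedge (Suc (Suc (Suc k)))" "\<gamma>' = (\<lambda>J. koszul_f f \<eta> J + koszul_y \<theta> J)" by blast
    have "koszul_f f (\<lambda>J. \<gamma> J - koszul_y \<eta> J) J = 0" for J
    proof -
      have "koszul_y (koszul_f f \<eta>) J = - koszul_f f \<gamma> J"
        using fun_cong[OF \<gamma>'(2), of J] by (simp add: \<eta>(2) koszul_map_add koszul_map_square)
      then show ?thesis
        using koszul_map_anticommute[of "\<lambda>j. to_S (f j)" "\<lambda>j. Var (Inr j)" \<eta> J]
        by (simp add: koszul_map_diff)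
    qed
    moreover have "(\<lambda>J. \<gamma> J - koszul_y \<eta> J) \<in> wedge (Suc (Suc k))"
      using Suc.prems(1) koszul_map_wedge[OF \<eta>(1), of "\<lambda>j. Var (Inr j)"] by (simp add: wedge_def)
    ultimately obtain \<eta>' where "\<eta>' \<in> wedge (Suc (Suc (Suc k)))" "(\<lambda>J. \<gamma> J - koszul_y \<eta> J) = koszul_f f \<eta>'"
      using exact_f by blast
    then show ?case using \<eta>(1) by (intro bexI[of _ \<eta>'] bexI[of _ \<eta>]) (auto simp: fun_eq_iff algebra_simps)
  qed
  then show ?thesis using eventually_trunc[of \<gamma>] by blast
qed

text \<open>Exactness at the free module \<open>\<wedge>\<^sup>1\<close>: if \<open>w = \<partial>\<^sub>y v\<close>, then \<open>\<partial>\<^sub>y \<partial>\<^sub>f v = - \<partial>\<^sub>f w = 0\<close>, so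
  \<open>v = \<partial>\<^sub>f \<eta> + \<partial>\<^sub>y \<theta>\<close> and \<open>w = \<partial>\<^sub>y \<partial>\<^sub>f \<eta>\<close>.\<close>

lemma buchsbaum_rim_exact_at_F:
  assumes "w \<in> wedge 1" "koszul_f f w = (\<lambda>J. 0)" "koszul_y w = (\<lambda>J. 0)"
  shows "\<exists>\<gamma>\<in>wedge 3. w = koszul_f f (koszul_y \<gamma>)"
proof -
  obtain v where v: "v \<in> wedge 2" "w = koszul_y v"
    using koszul_y_exact[OF _ assms(1,3)] by (auto simp: numeral_2_eq_2)
  have "koszul_y (koszul_f f v) = (\<lambda>J. 0)"
    by (rule ext, subst koszul_map_anticommute) (simp add: assms(2) flip: v(2))
  then obtain \<eta> \<theta> where \<eta>: "\<eta> \<in> wedge 3" "v = (\<lambda>J. koszul_f f \<eta> J + koszul_y \<theta> J)"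
    using kernel_double_koszul[of v 0] v(1) by (auto simp: numeral_2_eq_2 numeral_3_eq_3)
  have "w J = koszul_f f (koszul_y (\<lambda>J. - \<eta> J)) J" for J
    unfolding v(2) \<eta>(2) koszul_map_add koszul_map_square koszul_map_uminus
    by (subst koszul_map_anticommute) simp
  moreover have "(\<lambda>J. - \<eta> J) \<in> wedge 3" using \<eta>(1) by (simp add: wedge_def)
  ultimately show ?thesis by blast
qed

text \<open>Here \<open>\<gamma>\<^sub>b\<close> is the coefficient at \<open>g\<^sub>2\<^bsup>*(b)\<^esup>\<close> of an element of \<open>C'\<close> with divided powers of total degree
  \<open>p\<close>. The equations for \<open>\<eta>\<close> are solved from the largest \<open>b\<close> downwards. For \<open>b = p\<close> this is
  \<open>kernel_double_koszul\<close>, and the third assumption is its hypothesis; for \<open>p = 0\<close> that is the whole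
  cycle condition. Once \<open>\<eta>\<^bsub>b+1\<^esub>\<close> is known, \<open>\<gamma>\<^sub>b - \<partial>\<^sub>y \<eta>\<^bsub>b+1\<^esub>\<close> is a cycle for \<open>\<partial>\<^sub>f\<close>.\<close>

lemma buchsbaum_rim_exact:
  assumes "\<And>b. b \<le> p \<Longrightarrow> \<gamma> b \<in> wedge (Suc (Suc k))"
    and "\<And>b J. b < p \<Longrightarrow> koszul_f f (\<gamma> b) J + koszul_y (\<gamma> (Suc b)) J = 0"
    and "koszul_y (koszul_f f (\<gamma> p)) = (\<lambda>J. 0)"
  shows "\<exists>\<eta>. (\<forall>b. \<eta> b \<in> wedge (Suc (Suc (Suc k)))) \<and>
    (\<forall>b\<le>p. \<forall>J. \<gamma> b J = koszul_f f (\<eta> b) J + koszul_y (\<eta> (Suc b)) J)"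
  using assms
proof (induction p arbitrary: \<gamma>)
  case 0
  then obtain \<eta> \<theta> where "\<eta> \<in> wedge (Suc (Suc (Suc k)))" "\<theta> \<in> wedge (Suc (Suc (Suc k)))"
    "\<gamma> 0 = (\<lambda>J. koszul_f f \<eta> J + koszul_y \<theta> J)"
    using kernel_double_koszul by blast
  then show ?case by (intro exI[of _ "case_nat \<eta> (\<lambda>_. \<theta>)"]) (simp split: nat.split)
next
  case (Suc p)
  have "\<exists>\<eta>. (\<forall>b. \<eta> b \<in> wedge (Suc (Suc (Suc k)))) \<and>
      (\<forall>b\<le>p. \<forall>J. \<gamma> (Suc b) J = koszul_f f (\<eta> b) J + koszul_y (\<eta> (Suc b)) J)"
    using Suc.prems by (intro Suc.IH) auto
  then obtain \<eta> where
    \<eta>: "\<And>b. \<eta> b \<in> wedge (Suc (Suc (Suc k)))"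
      "\<And>b J. b \<le> p \<Longrightarrow> \<gamma> (Suc b) J = koszul_f f (\<eta> b) J + koszul_y (\<eta> (Suc b)) J"
    by blast
  have "koszul_f f (\<lambda>J. \<gamma> 0 J - koszul_y (\<eta> 0) J) J = 0" for J
  proof -
    have "\<gamma> (Suc 0) = (\<lambda>J. koszul_f f (\<eta> 0) J + koszul_y (\<eta> (Suc 0)) J)"
      using \<eta>(2)[of 0] by auto
    then have "koszul_y (\<gamma> (Suc 0)) J = koszul_y (koszul_f f (\<eta> 0)) J"
      by (simp add: koszul_map_add koszul_map_square)
    then show ?thesis
      using Suc.prems(2)[of 0 J] koszul_map_anticommute[of "\<lambda>j. to_S (f j)" "\<lambda>j. Var (Inr j)" "\<eta> 0" J]
      by (simp add: koszul_map_diff)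
  qed
  moreover have "(\<lambda>J. \<gamma> 0 J - koszul_y (\<eta> 0) J) \<in> wedge (Suc (Suc k))"
    using Suc.prems(1)[of 0] koszul_map_wedge[OF \<eta>(1)[of 0], of "\<lambda>j. Var (Inr j)"] by (simp add: wedge_def)
  ultimately obtain \<eta>0 where \<eta>0: "\<eta>0 \<in> wedge (Suc (Suc (Suc k)))"
      "(\<lambda>J. \<gamma> 0 J - koszul_y (\<eta> 0) J) = koszul_f f \<eta>0"
    using exact_f by blast
  show ?case
  proof (intro exI[of _ "case_nat \<eta>0 \<eta>"] conjI allI impI)
    fix b J assume "b \<le> Suc p"
    then show "\<gamma> b J = koszul_f f (case_nat \<eta>0 \<eta> b) J + koszul_y (case_nat \<eta>0 \<eta> (Suc b)) J"
      using fun_cong[OF \<eta>0(2), of J] \<eta>(2) by (cases b) (auto simp: algebra_simps)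
  qed (use \<eta>0(1) \<eta>(1) in \<open>simp split: nat.split\<close>)
qed

end

section \<open>Ideals of linear type\<close>

definition Sym_eval :: "('r::comm_ring_1, 'r) mpoly \<Rightarrow> 'r poly" where
  "Sym_eval = eval_mpoly (\<lambda>r. [:r:]) (\<lambda>a. monom a 1)"

lemma ring_hom_pCons: "ring_hom (\<lambda>r. [:r:])"
  by (rule ring_homI) (simp_all add: one_pCons)

lemma ring_hom_Sym_eval: "ring_hom Sym_eval"
  unfolding Sym_eval_def by (intro ring_hom_eval_mpoly ring_hom_pCons)

lemmas Sym_eval_simps = ring_hom_simps[OF ring_hom_Sym_eval]

lemma Sym_eval_Const: "Sym_eval (Const r) = [:r:]"
  by (simp add: Sym_eval_def eval_mpoly_Const)

lemma Sym_eval_Var: "Sym_eval (Var a) = monom a 1"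
  by (simp add: Sym_eval_def eval_mpoly_Var one_pCons)

lemma Sym_eval_Sym_ideal:
  assumes "P \<in> Sym_ideal I"
  shows "Sym_eval P = 0"
proof -
  have rel: "Sym_eval t = 0" if "t \<in> Sym_rels I" for t
    using that unfolding Sym_rels_def
    by (auto simp: Sym_eval_simps Sym_eval_Const Sym_eval_Var add_monom smult_monom
        simp flip: add_monom)
  obtain T c where P: "P = (\<Sum>t\<in>T. c t * t)" and "T \<subseteq> Sym_rels I"
    using assms unfolding Sym_ideal_def by auto
  then have "Sym_eval t = 0" if "t \<in> T" for t using rel that by auto
  then show ?thesis by (simp add: P Sym_eval_simps)
qed

lemma zero_in_Sym_ideal: "0 \<in> Sym_ideal I"
  unfolding Sym_ideal_def by (rule CollectI, intro exI[of _ "{}"] exI[of _ "\<lambda>_. 0"]) simp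

lemma Sym_to_Rees_coset: "Sym_to_Rees (P +o Sym_ideal I) = Sym_eval P"
proof -
  have "Sym_eval ` (P +o Sym_ideal I) = {Sym_eval P}"
    using zero_in_Sym_ideal[of I]
    by (auto simp: elt_set_plus_def Sym_eval_simps Sym_eval_Sym_ideal image_iff)
  then show ?thesis by (simp add: Sym_to_Rees_def Sym_eval_def)
qed

lemma linear_type_image:
  assumes "linear_type I"
  shows "Sym_eval ` Sym_free I = Rees I"
proof -
  have "Sym_to_Rees ` Sym I = Rees I" using assms by (simp add: linear_type_def bij_betw_def)
  moreover have "Sym_to_Rees ` Sym I = Sym_eval ` Sym_free I"
  proof -
    have "Sym I = (\<lambda>P. P +o Sym_ideal I) ` Sym_free I" unfolding Sym_def by auto
    then show ?thesis by (simp add: image_image Sym_to_Rees_coset)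
  qed
  ultimately show ?thesis by simp
qed

lemma linear_type_kernel:
  assumes "linear_type I" "P \<in> Sym_free I" "Sym_eval P = 0"
  shows "P \<in> Sym_ideal I"
proof -
  have zero: "0 \<in> Sym_free I" by (simp add: Sym_free_def)
  have "inj_on Sym_to_Rees (Sym I)" using assms(1) by (simp add: linear_type_def bij_betw_def)
  moreover have "Sym_to_Rees (P +o Sym_ideal I) = Sym_to_Rees (0 +o Sym_ideal I)"
    by (simp only: Sym_to_Rees_coset assms(3)) (simp add: Sym_eval_simps)
  ultimately have "P +o Sym_ideal I = 0 +o Sym_ideal I"
    by (rule inj_onD) (use assms(2) zero in \<open>unfold Sym_def, blast+\<close>)
  moreover have "P \<in> P +o Sym_ideal I"
    using zero_in_Sym_ideal[of I] by (auto simp: elt_set_plus_def)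
  ultimately show ?thesis by (auto simp: elt_set_plus_def)
qed

lemma ring_hom_pCons_Const: "ring_hom (\<lambda>c. [:Const c:])"
  by (rule ring_homI) (simp_all add: ring_hom_simps[OF ring_hom_Const] one_pCons)

lemma ring_hom_rees_map: "ring_hom (rees_map f)"
  unfolding rees_map_def by (intro ring_hom_eval_mpoly ring_hom_pCons_Const)

lemmas rees_map_simps = ring_hom_simps[OF ring_hom_rees_map]

lemma rees_map_Const: "rees_map f (Const a) = [:Const a:]"
  by (simp add: rees_map_def eval_mpoly_Const)

lemma rees_map_Var: "rees_map f (Var (Inl i)) = [:Var i:]" "rees_map f (Var (Inr j)) = monom (f j) 1"
  by (simp_all add: rees_map_def eval_mpoly_Var one_pCons)

lemma rees_map_to_S: "rees_map f (to_S b) = [:b:]"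
proof -
  have "rees_map f (to_S b) = eval_mpoly (\<lambda>a. [:Const a:]) (\<lambda>i. [:Var i:]) b"
    unfolding to_S_def eval_mpoly_compose[OF ring_hom_rees_map]
    by (simp add: rees_map_Const rees_map_Var)
  also have "\<dots> = [:eval_mpoly Const Var b:]"
    by (rule eval_mpoly_compose[OF ring_hom_pCons, symmetric])
  finally show ?thesis by (simp add: eval_mpoly_Const_Var)
qed

lemma Sym_free_add: "P \<in> Sym_free I \<Longrightarrow> Q \<in> Sym_free I \<Longrightarrow> P + Q \<in> Sym_free I"
  using keys_add[of P Q] by (auto simp: Sym_free_def)

lemma keys_mon_add: "Poly_Mapping.keys (m + m' :: 'v mon) = Poly_Mapping.keys m \<union> Poly_Mapping.keys m'"
  by (auto simp: in_keys_iff lookup_add)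

lemma Sym_free_mult: "P \<in> Sym_free I \<Longrightarrow> Q \<in> Sym_free I \<Longrightarrow> P * Q \<in> Sym_free I"
  using keys_mult[of P Q] by (fastforce simp: Sym_free_def keys_mon_add)

lemma Sym_free_Const: "Const r \<in> Sym_free I"
  by (simp add: Sym_free_def Const_def)

lemma Sym_free_Var_power: "a \<in> I \<Longrightarrow> Var a ^ k \<in> Sym_free I"
  by (auto simp: Sym_free_def Var_power)

lemma Sym_free_eval:
  assumes "\<And>c. u c \<in> Sym_free I" "\<And>v k. g v ^ k \<in> Sym_free I"
  shows "eval_mpoly u g s \<in> Sym_free I"
proof -
  have sum: "sum h X \<in> Sym_free I" if "\<And>x. h x \<in> Sym_free I" for h :: "'d mon \<Rightarrow> _" and X
    using Sym_free_Const[of 0 I]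
    by (induction X rule: infinite_finite_induct) (auto intro: Sym_free_add that)
  have prod: "prod h X \<in> Sym_free I" if "\<And>x. h x \<in> Sym_free I" for h :: "'d \<Rightarrow> _" and X
    using Sym_free_Const[of 1 I]
    by (induction X rule: infinite_finite_induct) (auto intro: Sym_free_mult that)
  show ?thesis unfolding eval_mpoly_def by (intro sum prod Sym_free_mult assms)
qed

text \<open>Choosing an expression \<open>a = \<Sum> c\<^sub>j f\<^sub>j\<close> for every \<open>a \<in> I\<close> gives a map from the polynomial ring
  on \<open>I\<close> back to \<open>S\<close> under which the relations of the symmetric algebra become linear syzygies.\<close>

locale ideal_presentation =
  fixes f :: "'y::finite \<Rightarrow> ('x, 'k::comm_ring_1) mpoly" and I :: "('x, 'k) mpoly set"
  assumes I_def: "I = ideal (range f)" and inj_f: "inj f"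
begin

text \<open>A generator is expressed by the corresponding unit vector, so that going from \<open>S\<close> to the
  polynomial ring on \<open>I\<close> and back is the identity.\<close>

definition coeffs :: "('x, 'k) mpoly \<Rightarrow> 'y \<Rightarrow> ('x, 'k) mpoly" where
  "coeffs a = (if a \<in> range f then (\<lambda>k. if f k = a then 1 else 0)
     else SOME c. a = (\<Sum>j\<in>UNIV. c j * f j))"

lemma coeffs: "a \<in> I \<Longrightarrow> (\<Sum>j\<in>UNIV. coeffs a j * f j) = a"
proof (cases "a \<in> range f")
  case True
  then obtain k where k: "a = f k" by auto
  then have "coeffs a j * f j = (if j = k then f k else 0)" for j
    using inj_f by (auto simp: coeffs_def inj_eq)
  then show ?thesis by (simp add: k)
next
  case False
  moreover assume "a \<in> I"
  then have "\<exists>c. a = (\<Sum>j\<in>UNIV. c j * f j)" unfolding I_def by (rule ideal_range_finite)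
  from someI_ex[OF this] have "a = (\<Sum>j\<in>UNIV. (SOME c. a = (\<Sum>j\<in>UNIV. c j * f j)) j * f j)" .
  ultimately show ?thesis by (simp add: coeffs_def)
qed

definition linear_form :: "('y \<Rightarrow> ('x, 'k) mpoly) \<Rightarrow> ('x + 'y, 'k) mpoly" where
  "linear_form w = (\<Sum>j\<in>UNIV. Var (Inr j) * to_S (w j))"

definition linear_syzygies :: "('x + 'y, 'k) mpoly set" where
  "linear_syzygies = {linear_form w | w. (\<Sum>j\<in>UNIV. w j * f j) = 0}"

lemma linear_form_arith:
  "linear_form (\<lambda>j. v j - w j) = linear_form v - linear_form w"
  "linear_form (\<lambda>j. r * w j) = to_S r * linear_form w"
  by (simp_all add: linear_form_def to_S_simps right_diff_distrib sum_subtractf sum_distrib_left mult.left_commute)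

lemma rees_map_linear_form: "rees_map f (linear_form w) = monom (\<Sum>j\<in>UNIV. w j * f j) 1"
  by (simp add: linear_form_def rees_map_simps rees_map_Var rees_map_to_S smult_monom flip: monom_sum)

definition from_Sym :: "(('x, 'k) mpoly, ('x, 'k) mpoly) mpoly \<Rightarrow> ('x + 'y, 'k) mpoly" where
  "from_Sym = eval_mpoly to_S (\<lambda>a. linear_form (coeffs a))"

definition into_Sym :: "('x + 'y, 'k) mpoly \<Rightarrow> (('x, 'k) mpoly, ('x, 'k) mpoly) mpoly" where
  "into_Sym = eval_mpoly (\<lambda>c. Const (Const c)) (case_sum (\<lambda>i. Const (Var i)) (\<lambda>j. Var (f j)))"

lemma ring_hom_from_Sym: "ring_hom from_Sym"
  unfolding from_Sym_def by (intro ring_hom_eval_mpoly ring_hom_to_S)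

lemmas from_Sym_simps = ring_hom_simps[OF ring_hom_from_Sym]

lemma from_Sym_Const: "from_Sym (Const b) = to_S b"
  by (simp add: from_Sym_def eval_mpoly_Const to_S_simps)

lemma from_Sym_Var: "from_Sym (Var a) = linear_form (coeffs a)"
  by (simp add: from_Sym_def eval_mpoly_Var to_S_simps)

lemma from_Sym_into_Sym: "from_Sym (into_Sym s) = s"
proof -
  have "coeffs (f j) k = (if k = j then 1 else 0)" for j k
    using inj_f by (auto simp: coeffs_def inj_eq)
  then have gen: "linear_form (coeffs (f j)) = Var (Inr j)" for j
    by (simp add: linear_form_def if_distrib[of to_S] if_distrib[of "(*) _"] to_S_simps cong: if_cong)
  have "from_Sym (into_Sym s) = eval_mpoly Const Var s"
    unfolding into_Sym_def eval_mpoly_compose[OF ring_hom_from_Sym]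
    by (intro eval_mpoly_cong) (auto simp: from_Sym_Const from_Sym_Var gen split: sum.split)
  then show ?thesis by (simp add: eval_mpoly_Const_Var)
qed

lemma Sym_eval_into_Sym: "Sym_eval (into_Sym s) = rees_map f s"
  unfolding into_Sym_def eval_mpoly_compose[OF ring_hom_Sym_eval] rees_map_def
  by (intro eval_mpoly_cong) (auto simp: Sym_eval_Const Sym_eval_Var split: sum.split)

lemma rees_map_from_Sym:
  assumes "P \<in> Sym_free I"
  shows "rees_map f (from_Sym P) = Sym_eval P"
  unfolding from_Sym_def eval_mpoly_compose[OF ring_hom_rees_map] Sym_eval_def
proof (rule eval_mpoly_cong)
  fix m a assume "m \<in> Poly_Mapping.keys P" "a \<in> Poly_Mapping.keys m"
  then have "a \<in> I" using assms by (auto simp: Sym_free_def)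
  then show "rees_map f (linear_form (coeffs a)) = monom a 1"
    by (simp add: rees_map_linear_form coeffs)
qed (rule rees_map_to_S)

lemma into_Sym_free: "into_Sym s \<in> Sym_free I"
  unfolding into_Sym_def
proof (rule Sym_free_eval)
  fix v k
  have "f j \<in> I" for j unfolding I_def by (auto intro: ideal.span_base)
  then show "case_sum (\<lambda>i. Const (Var i)) (\<lambda>j. Var (f j)) v ^ k \<in> Sym_free I"
    by (cases v) (auto simp: Sym_free_Const Sym_free_Var_power simp flip: ring_hom_simps(7)[OF ring_hom_Const])
qed (rule Sym_free_Const)

lemma from_Sym_Sym_rels:
  assumes "t \<in> Sym_rels I"
  shows "from_Sym t \<in> linear_syzygies"
proof -
  consider a b where "a \<in> I" "b \<in> I" "t = Var (a + b) - Var a - Var b"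
    | r a where "a \<in> I" "t = Var (r * a) - Const r * Var a"
    using assms unfolding Sym_rels_def by blast
  then show ?thesis
  proof cases
    case 1
    have "a + b \<in> I" using 1 unfolding I_def by (intro ideal.span_add)
    then have "(\<Sum>j\<in>UNIV. (coeffs (a + b) j - coeffs a j - coeffs b j) * f j) = 0"
      using 1 by (simp add: left_diff_distrib sum_subtractf coeffs)
    moreover have "from_Sym t = linear_form (\<lambda>j. coeffs (a + b) j - coeffs a j - coeffs b j)"
      by (simp add: 1 from_Sym_simps from_Sym_Var linear_form_arith)
    ultimately show ?thesis unfolding linear_syzygies_def by blast
  next
    case 2
    have "r * a \<in> I" using 2 unfolding I_def by (intro ideal.span_scale)
    then have "(\<Sum>j\<in>UNIV. (coeffs (r * a) j - r * coeffs a j) * f j) = 0"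
      using 2 by (simp add: left_diff_distrib sum_subtractf coeffs mult.assoc flip: sum_distrib_left)
    moreover have "from_Sym t = linear_form (\<lambda>j. coeffs (r * a) j - r * coeffs a j)"
      by (simp add: 2 from_Sym_simps from_Sym_Var from_Sym_Const linear_form_arith)
    ultimately show ?thesis unfolding linear_syzygies_def by blast
  qed
qed

text \<open>The image of \<open>s\<close> in the polynomial ring on \<open>I\<close> has value \<open>0\<close> in \<open>B[t]\<close>, so linear type puts it
  in the ideal of relations. The map back to \<open>S\<close> recovers \<open>s\<close> and sends relations to linear
  syzygies.\<close>

lemma kernel_rees_map:
  assumes "linear_type I" "rees_map f s = 0"
  shows "s \<in> ideal linear_syzygies"
proof -
  have "into_Sym s \<in> Sym_ideal I"
    using assms by (intro linear_type_kernel into_Sym_free) (simp_all add: Sym_eval_into_Sym)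
  then obtain T c where s: "into_Sym s = (\<Sum>t\<in>T. c t * t)" and T: "T \<subseteq> Sym_rels I"
    unfolding Sym_ideal_def by auto
  have "from_Sym (into_Sym s) \<in> ideal linear_syzygies"
    unfolding s from_Sym_simps
    by (intro ideal.span_sum ideal.span_scale ideal.span_base from_Sym_Sym_rels) (use T in auto)
  then show ?thesis by (simp add: from_Sym_into_Sym)
qed

lemma range_rees_map:
  assumes "linear_type I"
  shows "range (rees_map f) = Rees I"
proof -
  have "rees_map f s \<in> Sym_eval ` Sym_free I" for s
    using into_Sym_free[of s] by (simp flip: Sym_eval_into_Sym)
  moreover have "Sym_eval P \<in> range (rees_map f)" if "P \<in> Sym_free I" for P
    using rees_map_from_Sym[OF that] by (metis rangeI)
  ultimately show ?thesis unfolding linear_type_image[OF assms, symmetric] by blast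
qed

end

section \<open>Base change of the resolution\<close>

lemma card_eq_1_sum: "(\<Sum>J :: 'y::finite set | card J = 1. g J) = (\<Sum>j\<in>UNIV. g {j})"
proof -
  have "{J :: 'y set. card J = 1} = range (\<lambda>j. {j})" by (auto simp: card_1_singleton_iff)
  then show ?thesis by (simp add: sum.reindex inj_on_def)
qed

locale resolution_data = ideal_presentation f I
  for f :: "'y::{finite,linorder} \<Rightarrow> ('x::finite, 'k::comm_ring_1) mpoly" and I +
  fixes d :: "'y \<Rightarrow> nat"
    and F :: "('b, ('x, 'k) mpoly, int) free_complex"
    and u :: 'b and e :: "'y \<Rightarrow> 'b"
    and \<nu> :: "nat \<Rightarrow> 'b \<Rightarrow> 'y set \<Rightarrow> ('x, 'k) mpoly"
  assumes F_finite: "finite (gens F i)"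
    and F_graded: "r \<in> gens F i \<Longrightarrow> s \<in> gens F (Suc i) \<Longrightarrow>
      homogeneous std_deg (dmat F (Suc i) r s) (gdeg F (Suc i) s - gdeg F i r)"
    and F_exact: "{v \<in> free_mod (gens F (Suc i)). differential F (Suc i) v = (\<lambda>_. 0)}
        = differential F (Suc (Suc i)) ` free_mod (gens F (Suc (Suc i)))"
    and F_minimal: "r \<in> gens F i \<Longrightarrow> s \<in> gens F (Suc i) \<Longrightarrow> dmat F (Suc i) r s \<in> ideal (range Var)"
    and F_0: "gens F 0 = {u}"
    and inj_e: "inj e" and F_1: "gens F 1 = range e"
    and F_1_deg: "gdeg F 1 (e j) = int (d j)" and F_1_dmat: "dmat F 1 u (e j) = f j"
    and hom_f: "homogeneous std_deg (f j) (int (d j))"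
    and comparison: "koszul_comparison f d F u e \<nu>"
begin

lemma F_exact_B:
  assumes "\<And>r. r \<in> gens F i \<Longrightarrow> (\<Sum>s\<in>gens F (Suc i). dmat F (Suc i) r s * v s) = 0"
  shows "\<exists>w. \<forall>s\<in>gens F (Suc i). v s = (\<Sum>t\<in>gens F (Suc (Suc i)). dmat F (Suc (Suc i)) s t * w t)"
proof -
  define v' where "v' s = (if s \<in> gens F (Suc i) then v s else 0)" for s
  have "v' \<in> free_mod (gens F (Suc i))" by (simp add: v'_def free_mod_def)
  moreover have "differential F (Suc i) v' = (\<lambda>_. 0)"
    using assms by (simp add: differential_def v'_def fun_eq_iff)
  ultimately have "v' \<in> differential F (Suc (Suc i)) ` free_mod (gens F (Suc (Suc i)))"
    using F_exact[of i] by blast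
  then obtain w where w: "v' = differential F (Suc (Suc i)) w" by auto
  have "v s = (\<Sum>t\<in>gens F (Suc (Suc i)). dmat F (Suc (Suc i)) s t * w t)"
    if "s \<in> gens F (Suc i)" for s
    using that fun_cong[OF w, of s] by (simp add: differential_def v'_def)
  then show ?thesis by blast
qed

lemma F_complex:
  assumes "r \<in> gens F i" "t \<in> gens F (Suc (Suc i))"
  shows "(\<Sum>s\<in>gens F (Suc i). dmat F (Suc i) r s * dmat F (Suc (Suc i)) s t) = 0"
proof -
  define w where "w t' = (if t' = t then 1 else 0 :: ('x, 'k) mpoly)" for t'
  have "w \<in> free_mod (gens F (Suc (Suc i)))" using assms by (simp add: w_def free_mod_def)
  then have "differential F (Suc (Suc i)) w \<in> {v \<in> free_mod (gens F (Suc i)). differential F (Suc i) v = (\<lambda>_. 0)}"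
    unfolding F_exact by (rule imageI)
  then have "differential F (Suc i) (differential F (Suc (Suc i)) w) r = 0" by simp
  moreover have "differential F (Suc (Suc i)) w s = dmat F (Suc (Suc i)) s t" if "s \<in> gens F (Suc i)" for s
    using that assms(2) F_finite[of "Suc (Suc i)"]
    by (simp add: differential_def w_def if_distrib[of "(*) _"] cong: if_cong)
  ultimately show ?thesis using assms(1) by (simp add: differential_def)
qed

definition F_map :: "nat \<Rightarrow> ('b \<Rightarrow> ('x + 'y, 'k) mpoly) \<Rightarrow> 'b \<Rightarrow> ('x + 'y, 'k) mpoly" where
  "F_map i v r = (\<Sum>s\<in>gens F i. to_S (dmat F i r s) * v s)"

lemma F_map_linear:
  "F_map i (\<lambda>s. v s + w s) r = F_map i v r + F_map i w r"
  "F_map i (\<lambda>s. v s - w s) r = F_map i v r - F_map i w r"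
  "F_map i (\<lambda>s. c * v s) r = c * F_map i v r"
  by (simp_all add: F_map_def distrib_left right_diff_distrib sum.distrib sum_subtractf
      sum_distrib_left mult.left_commute)

lemma F_map_cong: "(\<And>s. s \<in> gens F i \<Longrightarrow> v s = w s) \<Longrightarrow> F_map i v r = F_map i w r"
  by (simp add: F_map_def)

lemma F_map_square:
  assumes "r \<in> gens F i"
  shows "F_map (Suc i) (F_map (Suc (Suc i)) w) r = 0"
proof -
  have "F_map (Suc i) (F_map (Suc (Suc i)) w) r =
    (\<Sum>s\<in>gens F (Suc i). \<Sum>t\<in>gens F (Suc (Suc i)). to_S (dmat F (Suc i) r s * dmat F (Suc (Suc i)) s t) * w t)"
    by (simp add: F_map_def sum_distrib_left to_S_simps mult.assoc)
  also have "\<dots> = (\<Sum>t\<in>gens F (Suc (Suc i)). to_S (\<Sum>s\<in>gens F (Suc i). dmat F (Suc i) r s * dmat F (Suc (Suc i)) s t) * w t)"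
    by (subst sum.swap) (simp add: to_S_simps sum_distrib_right)
  also have "\<dots> = 0" using F_complex[OF assms] by (simp add: to_S_simps)
  finally show ?thesis .
qed

lemma F_map_exact:
  assumes "\<And>r. r \<in> gens F i \<Longrightarrow> F_map (Suc i) V r = 0"
  shows "\<exists>W. \<forall>s\<in>gens F (Suc i). V s = F_map (Suc (Suc i)) W s"
  unfolding F_map_def
proof (rule base_change_exact[where P = "gens F i" and M = "dmat F (Suc i)"])
  show "finite (gens F (Suc i))" by (rule F_finite)
  show "\<exists>w. \<forall>s\<in>gens F (Suc i). v s = (\<Sum>t\<in>gens F (Suc (Suc i)). dmat F (Suc (Suc i)) s t * w t)"
    if "\<And>r. r \<in> gens F i \<Longrightarrow> (\<Sum>s\<in>gens F (Suc i). dmat F (Suc i) r s * v s) = 0" for v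
    using that by (rule F_exact_B)
  show "(\<Sum>s\<in>gens F (Suc i). to_S (dmat F (Suc i) r s) * V s) = 0" if "r \<in> gens F i" for r
    using assms[OF that] by (simp add: F_map_def)
qed

lemma sum_F_1: "(\<Sum>s\<in>gens F 1. g s) = (\<Sum>j\<in>UNIV. g (e j))"
  unfolding F_1 using inj_e by (simp add: sum.reindex)

definition \<nu>_map :: "nat \<Rightarrow> ('y set \<Rightarrow> ('x + 'y, 'k) mpoly) \<Rightarrow> 'b \<Rightarrow> ('x + 'y, 'k) mpoly" where
  "\<nu>_map i \<gamma> r = (\<Sum>J | card J = i. to_S (\<nu> i r J) * \<gamma> J)"

lemma \<nu>_map_linear:
  "\<nu>_map i (\<lambda>J. \<gamma> J + \<delta> J) r = \<nu>_map i \<gamma> r + \<nu>_map i \<delta> r"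
  "\<nu>_map i (\<lambda>J. - \<gamma> J) r = - \<nu>_map i \<gamma> r"
  "\<nu>_map i (\<lambda>J. 0) r = 0"
  by (simp_all add: \<nu>_map_def distrib_left sum.distrib sum_negf)

lemma F_map_\<nu>_map:
  assumes r: "r \<in> gens F i" and \<gamma>: "\<gamma> \<in> wedge (Suc i)"
  shows "F_map (Suc i) (\<nu>_map (Suc i) \<gamma>) r = \<nu>_map i (koszul_f f \<gamma>) r"
proof -
  have comm: "(\<Sum>s\<in>gens F (Suc i). dmat F (Suc i) r s * \<nu> (Suc i) s J)
      = (\<Sum>J' | card J' = i. \<nu> i r J' * koszul f J' J)" if "card J = Suc i" for J
    using comparison r that unfolding koszul_comparison_def by blast
  have "F_map (Suc i) (\<nu>_map (Suc i) \<gamma>) r =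
      (\<Sum>J | card J = Suc i. to_S (\<Sum>s\<in>gens F (Suc i). dmat F (Suc i) r s * \<nu> (Suc i) s J) * \<gamma> J)"
    unfolding F_map_def \<nu>_map_def sum_distrib_left to_S_simps sum_distrib_right
    by (subst sum.swap) (simp add: mult.assoc)
  also have "\<dots> = (\<Sum>J | card J = Suc i. \<Sum>J' | card J' = i. to_S (\<nu> i r J') * (koszul (\<lambda>j. to_S (f j)) J' J * \<gamma> J))"
    by (simp add: comm to_S_simps to_S_koszul sum_distrib_right mult.assoc)
  also have "\<dots> = (\<Sum>J' | card J' = i. to_S (\<nu> i r J') * koszul_f f \<gamma> J')"
    unfolding koszul_map_on_wedge[OF \<gamma>] sum_distrib_left by (rule sum.swap)
  finally show ?thesis by (simp add: \<nu>_map_def)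
qed


lemma \<nu>_map_1: "\<nu>_map 1 \<gamma> (e j) = \<gamma> {j}"
proof -
  have "\<nu> 1 (e j) {k} = (if j = k then 1 else 0)" for k
    using comparison unfolding koszul_comparison_def by blast
  then show ?thesis
    unfolding \<nu>_map_def card_eq_1_sum
    by (simp add: if_distrib[of to_S] if_distrib[of "\<lambda>t. t * _"] to_S_simps cong: if_cong)
qed


section \<open>The mapping cone in coordinates\<close>

abbreviation R :: "(('y, 'b) res_gen, ('x + 'y, 'k) mpoly, int \<times> int) free_complex" where
  "R \<equiv> rees_resolution f d F e \<nu>"

definition F_part :: "(('y, 'b) res_gen \<Rightarrow> ('x + 'y, 'k) mpoly) \<Rightarrow> 'b \<Rightarrow> ('x + 'y, 'k) mpoly" where
  "F_part v s = v (FGen s)"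

text \<open>An element of \<open>C'\<^sub>i\<close> is a family of exterior forms \<open>\<gamma>\<^sub>b\<close>, \<open>b < i\<close>, where \<open>\<gamma>\<^sub>b\<close> is the coefficient of
  \<open>g\<^sub>1\<^bsup>*(i-1-b)\<^esup> g\<^sub>2\<^bsup>*(b)\<^esup>\<close>. Outside this range \<open>C_part\<close> is \<open>0\<close>.\<close>

definition C_part ::
  "nat \<Rightarrow> (('y, 'b) res_gen \<Rightarrow> ('x + 'y, 'k) mpoly) \<Rightarrow> nat \<Rightarrow> 'y set \<Rightarrow> ('x + 'y, 'k) mpoly" where
  "C_part i v b J = (if b < i \<and> card J = i + 2 then v (CGen (J, i - 1 - b, b)) else 0)"

text \<open>Conversely, the vector in homological degree \<open>i\<close> with components \<open>V\<close> in \<open>F'\<^bsub>i+1\<^esub>\<close> and \<open>\<gamma>\<close> in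
  \<open>C'\<^bsub>i-1\<^esub>\<close>.\<close>

definition res_vector ::
  "nat \<Rightarrow> ('b \<Rightarrow> ('x + 'y, 'k) mpoly) \<Rightarrow> (nat \<Rightarrow> 'y set \<Rightarrow> ('x + 'y, 'k) mpoly)
    \<Rightarrow> ('y, 'b) res_gen \<Rightarrow> ('x + 'y, 'k) mpoly" where
  "res_vector i V \<gamma> g = (case g of One \<Rightarrow> 0
     | FGen s \<Rightarrow> if s \<in> gens F (Suc i) then V s else 0
     | CGen c \<Rightarrow> if c \<in> br_gens (i - 1) then (case c of (J, a, b) \<Rightarrow> \<gamma> b J) else 0)"

lemma res_vector_free_mod: "res_vector (Suc i) V \<gamma> \<in> free_mod (gens R (Suc i))"
  by (auto simp: free_mod_def res_vector_def rees_resolution_def res_gens_def split: res_gen.split)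

lemma F_part_res_vector: "s \<in> gens F (Suc i) \<Longrightarrow> F_part (res_vector i V \<gamma>) s = V s"
  by (simp add: F_part_def res_vector_def)

lemma C_part_res_vector:
  assumes "b < i" "\<gamma> b \<in> wedge (i + 2)"
  shows "C_part i (res_vector (Suc i) V \<gamma>) b = \<gamma> b"
  using assms by (auto simp: C_part_def res_vector_def br_gens_def wedge_def fun_eq_iff)

lemma C_part_wedge: "C_part i v b \<in> wedge (Suc (Suc i))"
  by (simp add: C_part_def wedge_def)

lemma sum_br_gens:
  "(\<Sum>c\<in>br_gens i. g c) = (\<Sum>b<i. \<Sum>J :: 'y set | card J = i + 2. g (J, i - 1 - b, b))"
proof -
  have "(\<Sum>b<i. \<Sum>J :: 'y set | card J = i + 2. g (J, i - 1 - b, b)) =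
      (\<Sum>(b, J)\<in>{..<i} \<times> {J :: 'y set. card J = i + 2}. g (J, i - 1 - b, b))"
    by (simp add: sum.cartesian_product)
  also have "\<dots> = (\<Sum>c\<in>br_gens i. g c)"
    by (rule sum.reindex_bij_witness[where i = "\<lambda>(J, a, b). (b, J)" and j = "\<lambda>(b, J). (J, i - 1 - b, b)"])
       (auto simp: br_gens_def)
  finally show ?thesis by simp
qed

lemma finite_br_gens: "finite (br_gens i :: 'y br_index set)"
  by (rule finite_subset[of _ "UNIV \<times> {..i} \<times> {..i}"]) (auto simp: br_gens_def)

lemma sum_res_gens:
  "(\<Sum>g\<in>gens R (Suc i). h g) = (\<Sum>s\<in>gens F (i + 2). h (FGen s)) + (\<Sum>c\<in>br_gens i. h (CGen c))"
proof -
  have "(\<Sum>g\<in>FGen ` gens F (i + 2) \<union> CGen ` br_gens i. h g) =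
      (\<Sum>g\<in>FGen ` gens F (i + 2). h g) + (\<Sum>g\<in>CGen ` br_gens i. h g)"
    using F_finite finite_br_gens by (intro sum.union_disjoint) auto
  then show ?thesis by (simp add: rees_resolution_def res_gens_def sum.reindex inj_on_def)
qed

lemma differential_One:
  "differential R (Suc 0) v One = (\<Sum>j\<in>UNIV. Var (Inr j) * F_map 2 (F_part v) (e j))"
proof -
  have "differential R (Suc 0) v One =
      (\<Sum>s\<in>gens F 2. (\<Sum>j\<in>UNIV. Var (Inr j) * to_S (dmat F 2 (e j) s)) * v (FGen s))"
    using sum_res_gens[of "\<lambda>s. dmat R (Suc 0) One s * v s" 0]
    by (simp add: differential_def sum_br_gens) (simp add: rees_resolution_def res_gens_def res_delta_def numeral_2_eq_2)
  also have "\<dots> = (\<Sum>j\<in>UNIV. Var (Inr j) * F_map 2 (F_part v) (e j))"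
    unfolding F_map_def F_part_def sum_distrib_right sum_distrib_left
    by (subst sum.swap) (simp add: mult.assoc)
  finally show ?thesis .
qed

text \<open>Only the form \<open>\<gamma>\<^sub>0\<close> contributes to the second summand, as \<open>\<alpha>\<close> vanishes on the other basis
  elements.\<close>

lemma differential_FGen:
  assumes "r \<in> gens F (Suc (Suc i))"
  shows "differential R (Suc (Suc i)) v (FGen r) = F_map (Suc (Suc (Suc i))) (F_part v) r
    + (- 1) ^ i * \<nu>_map (Suc (Suc i)) (koszul_y (C_part (Suc i) v 0)) r"
proof -
  have "(\<Sum>c\<in>br_gens (Suc i). br_alpha \<nu> (Suc i) r c * v (CGen c)) =
      (\<Sum>b<Suc i. if b = 0 then (\<Sum>J | card J = Suc i + 2. br_alpha \<nu> (Suc i) r (J, i, 0) * v (CGen (J, i, 0))) else 0)"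
    unfolding sum_br_gens by (intro sum.cong refl) (auto simp: br_alpha_def)
  also have "\<dots> = (\<Sum>J | card J = Suc i + 2. br_alpha \<nu> (Suc i) r (J, i, 0) * v (CGen (J, i, 0)))"
    by (subst sum.delta) auto
  also have "\<dots> = (\<Sum>J | card J = Suc i + 2. \<Sum>J' | card J' = Suc (Suc i).
      (- 1) ^ i * (to_S (\<nu> (Suc (Suc i)) r J') * (koszul (\<lambda>j. Var (Inr j)) J' J * C_part (Suc i) v 0 J)))"
    by (intro sum.cong refl) (simp add: br_alpha_def C_part_def sum_distrib_left sum_distrib_right mult.assoc)
  also have "\<dots> = (- 1) ^ i * \<nu>_map (Suc (Suc i)) (koszul_y (C_part (Suc i) v 0)) r"
    unfolding \<nu>_map_def koszul_map_on_wedge[OF C_part_wedge] sum_distrib_left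
    by (subst sum.swap) simp
  finally have alpha: "(\<Sum>c\<in>br_gens (Suc i). br_alpha \<nu> (Suc i) r c * v (CGen c)) = \<dots>" .
  have r: "FGen r \<in> gens R (Suc i)" using assms by (simp add: rees_resolution_def res_gens_def)
  have "differential R (Suc (Suc i)) v (FGen r) = F_map (Suc (Suc (Suc i))) (F_part v) r +
      (\<Sum>c\<in>br_gens (Suc i). br_alpha \<nu> (Suc i) r c * v (CGen c))"
    using r unfolding differential_def sum_res_gens
    by (simp add: F_map_def F_part_def) (simp add: rees_resolution_def res_delta_def)
  then show ?thesis unfolding alpha .
qed

lemma differential_CGen:
  assumes "b < i" "card J = i + 2"
  shows "differential R (Suc (Suc i)) v (CGen (J, i - 1 - b, b)) =
    - (koszul_f f (C_part (Suc i) v b) J + koszul_y (C_part (Suc i) v (Suc b)) J)"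
proof -
  let ?kf = "koszul (\<lambda>j. to_S (f j)) J" and ?ky = "koszul (\<lambda>j. Var (Inr j)) J"
  have c: "CGen (J, i - 1 - b, b) \<in> gens R (Suc i)"
    using assms by (auto simp: rees_resolution_def res_gens_def br_gens_def)
  have "br_sigma f (J, i - 1 - b, b) (J', Suc i - 1 - b', b') =
      (if b' = b then ?kf J' else 0) + (if b' = Suc b then ?ky J' else 0)" if "b' < Suc i" for J' b'
    using assms that by (auto simp: br_sigma_def)
  then have "(\<Sum>c\<in>br_gens (Suc i). br_sigma f (J, i - 1 - b, b) c * v (CGen c)) =
      (\<Sum>b'<Suc i. \<Sum>J' | card J' = Suc i + 2.
        ((if b' = b then ?kf J' else 0) + (if b' = Suc b then ?ky J' else 0)) * C_part (Suc i) v b' J')"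
    unfolding sum_br_gens by (intro sum.cong refl) (simp add: C_part_def)
  also have "\<dots> = (\<Sum>b'<Suc i. (if b' = b then koszul_f f (C_part (Suc i) v b) J else 0)
        + (if b' = Suc b then koszul_y (C_part (Suc i) v (Suc b)) J else 0))"
    by (intro sum.cong refl) (auto simp: koszul_map_on_wedge[OF C_part_wedge])
  also have "\<dots> = koszul_f f (C_part (Suc i) v b) J + koszul_y (C_part (Suc i) v (Suc b)) J"
    using assms(1) by (simp add: sum.distrib sum.delta)
  finally have sigma: "(\<Sum>c\<in>br_gens (Suc i). br_sigma f (J, i - 1 - b, b) c * v (CGen c)) = \<dots>" .
  have "differential R (Suc (Suc i)) v (CGen (J, i - 1 - b, b)) =
      - (\<Sum>c\<in>br_gens (Suc i). br_sigma f (J, i - 1 - b, b) c * v (CGen c))"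
    using c unfolding differential_def sum_res_gens
    by simp (simp add: rees_resolution_def res_delta_def sum_negf)
  then show ?thesis unfolding sigma .
qed

lemma differential_outside: "g \<notin> gens R i \<Longrightarrow> differential R (Suc i) v g = 0"
  by (simp add: differential_def)

lemma gens_R_0: "gens R 0 = {One}"
  by (simp add: rees_resolution_def res_gens_def)

lemma gens_R_cases:
  assumes "g \<in> gens R (Suc i)"
  obtains (F) s where "g = FGen s" "s \<in> gens F (Suc (Suc i))"
    | (C) J b where "g = CGen (J, i - 1 - b, b)" "b < i" "card J = i + 2"
proof -
  have "g \<in> FGen ` gens F (Suc (Suc i)) \<union> CGen ` br_gens i"
    using assms by (simp add: rees_resolution_def res_gens_def)
  then consider s where "g = FGen s" "s \<in> gens F (Suc (Suc i))"
    | J a b where "g = CGen (J, a, b)" "card J = i + 2" "a + b + 1 = i"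
    by (auto simp: br_gens_def)
  then show thesis
  proof cases
    case (2 J a b)
    then have "a = i - 1 - b" "b < i" by auto
    with 2 show thesis using that(2) by blast
  qed (rule that(1))
qed


lemma res_vector_eqI:
  assumes "v \<in> free_mod (gens R (Suc i))"
    and "\<And>s. s \<in> gens F (Suc (Suc i)) \<Longrightarrow> v (FGen s) = w (FGen s)"
    and "\<And>J b. b < i \<Longrightarrow> card J = i + 2 \<Longrightarrow> v (CGen (J, i - 1 - b, b)) = w (CGen (J, i - 1 - b, b))"
    and "\<And>g. g \<notin> gens R (Suc i) \<Longrightarrow> w g = 0"
  shows "v = w"
proof
  fix g
  show "v g = w g"
  proof (cases "g \<in> gens R (Suc i)")
    case True
    then show ?thesis
    proof (cases rule: gens_R_cases)
      case (F s)
      then show ?thesis using assms(2) by simp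
    next
      case (C J b)
      show ?thesis unfolding C(1) by (rule assms(3)[OF C(2,3)])
    qed
  next
    case False
    then show ?thesis using assms(1,4) by (simp add: free_mod_def)
  qed
qed

section \<open>The mapping cone is a complex\<close>


lemma F_part_differential:
  assumes "r \<in> gens F (Suc (Suc i))"
  shows "F_part (differential R (Suc (Suc i)) v) r = F_map (Suc (Suc (Suc i))) (F_part v) r
    + (- 1) ^ i * \<nu>_map (Suc (Suc i)) (koszul_y (C_part (Suc i) v 0)) r"
  unfolding F_part_def[of "differential R (Suc (Suc i)) v"] by (rule differential_FGen) fact

lemma C_part_differential:
  assumes "b < i"
  shows "C_part i (differential R (Suc (Suc i)) v) b =
    (\<lambda>J. - (koszul_f f (C_part (Suc i) v b) J + koszul_y (C_part (Suc i) v (Suc b)) J))"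
proof
  fix J
  show "C_part i (differential R (Suc (Suc i)) v) b J =
    - (koszul_f f (C_part (Suc i) v b) J + koszul_y (C_part (Suc i) v (Suc b)) J)"
  proof (cases "card J = i + 2")
    case True
    with assms show ?thesis by (simp add: C_part_def differential_CGen[unfolded diff_diff_left plus_1_eq_Suc])
  next
    case False
    have "koszul_f f (C_part (Suc i) v b) \<in> wedge (Suc (Suc i))"
      "koszul_y (C_part (Suc i) v (Suc b)) \<in> wedge (Suc (Suc i))"
      by (intro koszul_map_wedge C_part_wedge)+
    with False show ?thesis by (simp add: C_part_def wedge_def)
  qed
qed

text \<open>This is \<open>\<phi>' \<alpha>\<close> written on forms: \<open>\<phi>' \<phi>' = 0\<close>, and \<open>\<phi>'\<close> is exchanged with \<open>\<partial>\<^sub>f\<close> by \<open>\<nu>'\<close>.\<close>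

lemma F_map_F_part_differential:
  assumes "r \<in> gens F (Suc i)"
  shows "F_map (Suc (Suc i)) (F_part (differential R (Suc (Suc i)) v)) r =
    (- 1) ^ i * \<nu>_map (Suc i) (koszul_f f (koszul_y (C_part (Suc i) v 0))) r"
proof -
  have "F_map (Suc (Suc i)) (F_part (differential R (Suc (Suc i)) v)) r =
      F_map (Suc (Suc i)) (\<lambda>s. F_map (Suc (Suc (Suc i))) (F_part v) s
        + (- 1) ^ i * \<nu>_map (Suc (Suc i)) (koszul_y (C_part (Suc i) v 0)) s) r"
    by (rule F_map_cong) (rule F_part_differential)
  also have "\<dots> = (- 1) ^ i * F_map (Suc (Suc i)) (\<nu>_map (Suc (Suc i)) (koszul_y (C_part (Suc i) v 0))) r"
    using assms by (simp add: F_map_linear F_map_square)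
  also have "\<dots> = (- 1) ^ i * \<nu>_map (Suc i) (koszul_f f (koszul_y (C_part (Suc i) v 0))) r"
    using assms by (simp add: F_map_\<nu>_map koszul_map_wedge C_part_wedge)
  finally show ?thesis .
qed

text \<open>At \<open>S\<close> the composite is \<open>\<partial>\<^sub>y \<partial>\<^sub>f \<partial>\<^sub>y = 0\<close>. In higher degrees the blocks of the composite vanish
  because \<open>\<phi>' \<phi>' = 0\<close>, \<open>\<phi>' \<alpha> = \<alpha> \<sigma>\<close> and \<open>\<sigma> \<sigma> = 0\<close>; on forms, the last two come down to
  \<open>\<partial>\<^sub>f \<partial>\<^sub>y = - \<partial>\<^sub>y \<partial>\<^sub>f\<close>.\<close>

lemma res_complex: "differential R (Suc i) (differential R (Suc (Suc i)) v) = (\<lambda>_. 0)"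
proof
  fix g
  let ?w = "differential R (Suc (Suc i)) v"
  show "differential R (Suc i) ?w g = 0"
  proof (cases i)
    case 0
    have "differential R (Suc 0) ?w One =
        (\<Sum>j\<in>UNIV. Var (Inr j) * koszul_f f (koszul_y (C_part (Suc 0) v 0)) {j})"
      unfolding differential_One using F_map_F_part_differential[of "e _" 0 v] 0 F_1 \<nu>_map_1
      by (simp add: numeral_2_eq_2)
    also have "\<dots> = 0" using koszul_yfy[where \<gamma> = "C_part (Suc 0) v 0" and J = "{}"] by (simp add: koszul_map_singletons)
    finally have "differential R (Suc 0) ?w One = 0" .
    then show ?thesis using 0 differential_outside[of g 0 ?w] gens_R_0 by (cases "g = One") auto
  next
    case (Suc i')
    show ?thesis
    proof (cases "g \<in> gens R (Suc i')")
      case True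
      then show ?thesis
      proof (cases rule: gens_R_cases)
        case (F r)
        have "koszul_y (C_part i ?w 0) = (\<lambda>J. koszul_f f (koszul_y (C_part (Suc i) v 0)) J)"
          using Suc by (simp add: C_part_differential koszul_map_linear koszul_map_square)
            (simp add: koszul_map_anticommute[of "\<lambda>j. Var (Inr j)" "\<lambda>j. to_S (f j)"])
        then show ?thesis
          using F Suc differential_FGen[of r i' ?w] F_map_F_part_differential[of r i v]
          by simp
      next
        case (C J b)
        have "C_part i ?w b = (\<lambda>J. - (koszul_f f (C_part (Suc i) v b) J + koszul_y (C_part (Suc i) v (Suc b)) J))"
          "C_part i ?w (Suc b) = (\<lambda>J. - (koszul_f f (C_part (Suc i) v (Suc b)) J + koszul_y (C_part (Suc i) v (Suc (Suc b))) J))"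
          using C Suc by (auto simp: C_part_differential)
        then show ?thesis
          using C Suc differential_CGen[of b i' J ?w]
          by (simp add: koszul_map_linear koszul_map_square)
             (simp add: koszul_map_anticommute[of "\<lambda>j. Var (Inr j)" "\<lambda>j. to_S (f j)"])
      qed
    next
      case False
      then show ?thesis using Suc differential_outside by blast
    qed
  qed
qed

end

section \<open>Exactness of the mapping cone\<close>

locale rees_exact = resolution_data f I d F u e \<nu> + buchsbaum_rim f
  for f :: "'y::{finite,linorder} \<Rightarrow> ('x::finite, 'k::comm_ring_1) mpoly" and I d
    and F :: "('b, ('x, 'k) mpoly, int) free_complex" and u e \<nu>
begin

text \<open>By the assumption on \<open>\<eta>\<close>, the boundary of the element of the cone with component \<open>\<eta>\<close> in \<open>C'\<close>
  and \<open>0\<close> in \<open>F'\<close> has the same component in \<open>C'\<close> as \<open>v\<close>. The difference lies in \<open>F'\<close>; by the last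
  assumption it is a cycle there, hence a boundary.\<close>

lemma lift_cycle:
  assumes v: "v \<in> free_mod (gens R (Suc i))"
    and \<eta>: "\<And>b. b \<le> i \<Longrightarrow> \<eta> b \<in> wedge (i + 3)"
    and C: "\<And>b J. b < i \<Longrightarrow> C_part i v b J = - (koszul_f f (\<eta> b) J + koszul_y (\<eta> (Suc b)) J)"
    and F: "\<And>r. r \<in> gens F (Suc i) \<Longrightarrow> F_map (Suc (Suc i)) (F_part v) r =
      (- 1) ^ i * \<nu>_map (Suc i) (koszul_f f (koszul_y (\<eta> 0))) r"
  shows "v \<in> differential R (Suc (Suc i)) ` free_mod (gens R (Suc (Suc i)))"
proof -
  let ?a = "\<lambda>s. (- 1) ^ i * \<nu>_map (Suc (Suc i)) (koszul_y (\<eta> 0)) s"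
  have y0: "koszul_y (\<eta> 0) \<in> wedge (Suc (Suc i))"
    using \<eta>[of 0] by (intro koszul_map_wedge) (simp add: numeral_3_eq_3)
  have "F_map (Suc (Suc i)) (\<lambda>s. F_part v s - ?a s) r = 0" if "r \<in> gens F (Suc i)" for r
    using that by (simp add: F_map_linear F F_map_\<nu>_map[OF _ y0])
  then obtain W where W: "\<And>s. s \<in> gens F (Suc (Suc i)) \<Longrightarrow> F_part v s - ?a s = F_map (Suc (Suc (Suc i))) W s"
    using F_map_exact[of "Suc i" "\<lambda>s. F_part v s - ?a s"] by blast
  define w where "w = res_vector (Suc (Suc i)) W \<eta>"
  have Cw: "C_part (Suc i) w b = \<eta> b" if "b \<le> i" for b
    unfolding w_def using that \<eta>[OF that] by (intro C_part_res_vector) (simp_all add: eval_nat_numeral)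
  have Fw: "F_map (Suc (Suc (Suc i))) (F_part w) r = F_map (Suc (Suc (Suc i))) W r" for r
    by (rule F_map_cong) (simp add: w_def F_part_res_vector)
  have "v = differential R (Suc (Suc i)) w"
  proof (rule res_vector_eqI[OF v])
    fix s assume s: "s \<in> gens F (Suc (Suc i))"
    show "v (FGen s) = differential R (Suc (Suc i)) w (FGen s)"
      using W[OF s] by (simp add: differential_FGen[OF s] Fw Cw F_part_def algebra_simps)
  next
    fix J :: "'y set" and b assume b: "b < i" and J: "card J = i + 2"
    show "v (CGen (J, i - 1 - b, b)) = differential R (Suc (Suc i)) w (CGen (J, i - 1 - b, b))"
      unfolding differential_CGen[OF b J] using C[OF b, of J] b J by (simp add: C_part_def Cw)
  qed (rule differential_outside)
  moreover have "w \<in> free_mod (gens R (Suc (Suc i)))"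
    unfolding w_def by (rule res_vector_free_mod)
  ultimately show ?thesis by blast
qed

text \<open>For \<open>v \<in> F\<^sub>2'\<close> with \<open>y \<phi>\<^sub>2' v = 0\<close>, the form \<open>w = \<phi>\<^sub>2' v\<close> of degree \<open>1\<close> is killed by both \<open>\<partial>\<^sub>y\<close> and
  \<open>\<partial>\<^sub>f\<close>. Hence \<open>w = \<partial>\<^sub>f \<partial>\<^sub>y \<gamma> = \<phi>\<^sub>2' \<alpha>\<^sub>1 \<gamma>\<close>, and \<open>v - \<alpha>\<^sub>1 \<gamma>\<close> is a cycle of \<open>F'\<close>.\<close>

lemma res_exact_0:
  assumes v: "v \<in> free_mod (gens R (Suc 0))" and 0: "differential R (Suc 0) v = (\<lambda>_. 0)"
  shows "v \<in> differential R (Suc (Suc 0)) ` free_mod (gens R (Suc (Suc 0)))"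
proof -
  define w where "w J = (\<Sum>j\<in>UNIV. if J = {j} then F_map 2 (F_part v) (e j) else 0)" for J
  have w1: "w \<in> wedge 1" by (auto simp: wedge_def w_def intro!: sum.neutral)
  have w: "w {j} = F_map 2 (F_part v) (e j)" for j by (simp add: w_def)
  have zero: "koszul_map z w = (\<lambda>J. 0)" if "(\<Sum>j\<in>UNIV. z j * w {j}) = 0" for z
  proof
    fix J
    show "koszul_map z w J = 0"
      using that koszul_map_wedge[of w 0 z] w1 koszul_map_singletons[of z w]
      by (cases "J = {}") (auto simp: wedge_def)
  qed
  have "koszul_y w = (\<lambda>J. 0)"
    using fun_cong[OF 0, of One] by (intro zero) (simp add: differential_One w)
  moreover have "koszul_f f w = (\<lambda>J. 0)"
  proof (rule zero)
    have "F_map (Suc 0) (F_map (Suc (Suc 0)) (F_part v)) u = 0" by (rule F_map_square) (simp add: F_0)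
    then show "(\<Sum>j\<in>UNIV. to_S (f j) * w {j}) = 0"
      using F_1_dmat by (simp add: w F_map_def[of "Suc 0"] numeral_2_eq_2 sum_F_1[unfolded One_nat_def])
  qed
  ultimately obtain \<gamma> where \<gamma>: "\<gamma> \<in> wedge 3" "w = koszul_f f (koszul_y \<gamma>)"
    using buchsbaum_rim_exact_at_F[OF w1] by blast
  show ?thesis
  proof (rule lift_cycle[OF v, where \<eta> = "\<lambda>_. \<gamma>"])
    fix r assume "r \<in> gens F (Suc 0)"
    then obtain j where "r = e j" using F_1 by auto
    then show "F_map (Suc (Suc 0)) (F_part v) r =
        (- 1) ^ 0 * \<nu>_map (Suc 0) (koszul_f f (koszul_y \<gamma>)) r"
      using w[of j] \<nu>_map_1[of w j] by (simp add: \<gamma>(2) numeral_2_eq_2)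
  qed (use \<gamma> in auto)
qed

lemma res_exact_Suc:
  assumes v: "v \<in> free_mod (gens R (Suc (Suc i)))" and 0: "differential R (Suc (Suc i)) v = (\<lambda>_. 0)"
  shows "v \<in> differential R (Suc (Suc (Suc i))) ` free_mod (gens R (Suc (Suc (Suc i))))"
proof -
  let ?\<gamma> = "C_part (Suc i) v"
  have F: "F_map (Suc (Suc (Suc i))) (F_part v) r = - ((- 1) ^ i * \<nu>_map (Suc (Suc i)) (koszul_y (?\<gamma> 0)) r)"
    if "r \<in> gens F (Suc (Suc i))" for r
    using differential_FGen[OF that, of v] 0 by (simp add: eq_neg_iff_add_eq_0)
  have cycle: "koszul_f f (?\<gamma> b) J + koszul_y (?\<gamma> (Suc b)) J = 0" if "b < i" for b J
    using fun_cong[OF C_part_differential[OF that, of v], of J] 0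
    by (simp add: C_part_def neg_eq_iff_add_eq_0)
  have last: "koszul_y (koszul_f f (?\<gamma> i)) = (\<lambda>J. 0)"
  proof (cases i)
    case 0
    \<comment> \<open>There is no condition from \<open>\<sigma>\<close>; instead \<open>\<phi>\<^sub>2'\<close> is applied to the component in \<open>F\<^sub>2'\<close> of the
      cycle condition, and \<open>\<phi>\<^sub>2' \<alpha>\<^sub>1 = \<partial>\<^sub>f \<partial>\<^sub>y\<close>.\<close>
    have "koszul_f f (koszul_y (?\<gamma> 0)) {j} = 0" for j
    proof -
      have "F_map 2 (F_map 3 (F_part v)) (e j) = 0"
        using F_map_square[of "e j" 1] F_1 by (simp add: numeral_2_eq_2 numeral_3_eq_3)
      moreover have "F_map 2 (F_map 3 (F_part v)) (e j) =
          F_map 2 (\<lambda>s. (- 1) * \<nu>_map 2 (koszul_y (?\<gamma> 0)) s) (e j)"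
        using F 0 by (intro F_map_cong) (simp add: numeral_2_eq_2 numeral_3_eq_3)
      moreover have "\<dots> = - koszul_f f (koszul_y (?\<gamma> 0)) {j}"
        unfolding F_map_linear
        using F_map_\<nu>_map[of "e j" 1 "koszul_y (?\<gamma> 0)"] F_1 0 \<nu>_map_1
        by (simp add: koszul_map_wedge C_part_wedge numeral_2_eq_2)
      ultimately show ?thesis by simp
    qed
    moreover have "koszul_f f (koszul_y (?\<gamma> 0)) \<in> wedge 1"
      using 0 by (simp add: koszul_map_wedge C_part_wedge)
    ultimately have "koszul_f f (koszul_y (?\<gamma> 0)) J = 0" for J
      by (cases "card J = 1") (auto simp: wedge_def card_1_singleton_iff)
    then have "koszul_f f (koszul_y (?\<gamma> 0)) = (\<lambda>J. 0)" by auto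
    then show ?thesis
      using 0 koszul_map_anticommute[of "\<lambda>j. Var (Inr j)" "\<lambda>j. to_S (f j)" "?\<gamma> 0"] by (simp add: fun_eq_iff)
  next
    case (Suc i')
    have "koszul_f f (?\<gamma> i') = (\<lambda>J. - koszul_y (?\<gamma> i) J)"
      using cycle[of i'] Suc by (simp add: fun_eq_iff eq_neg_iff_add_eq_0)
    then have "koszul_f f (koszul_f f (?\<gamma> i')) = (\<lambda>J. - koszul_f f (koszul_y (?\<gamma> i)) J)"
      by (simp only: koszul_map_uminus)
    then have "koszul_f f (koszul_y (?\<gamma> i)) = (\<lambda>J. 0)"
      unfolding koszul_map_square by (simp add: fun_eq_iff)
    then show ?thesis
      using koszul_map_anticommute[of "\<lambda>j. Var (Inr j)" "\<lambda>j. to_S (f j)" "?\<gamma> i"] by (simp add: fun_eq_iff)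
  qed
  obtain \<eta> where \<eta>: "\<And>b. \<eta> b \<in> wedge (Suc (Suc (Suc (Suc i))))"
      "\<And>b J. b \<le> i \<Longrightarrow> ?\<gamma> b J = koszul_f f (\<eta> b) J + koszul_y (\<eta> (Suc b)) J"
    using buchsbaum_rim_exact[of i ?\<gamma> "Suc i", OF C_part_wedge cycle last] by blast
  (* The block of the cone on C' is - sigma, whence the sign of the preimage. *)
  show ?thesis
  proof (rule lift_cycle[OF v, where \<eta> = "\<lambda>b J. - \<eta> b J"])
    fix b J assume "b < Suc i"
    then show "?\<gamma> b J = - (koszul_f f (\<lambda>J. - \<eta> b J) J + koszul_y (\<lambda>J. - \<eta> (Suc b) J) J)"
      by (simp add: \<eta>(2) koszul_map_uminus)
  next
    fix r assume r: "r \<in> gens F (Suc (Suc i))"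
    have "?\<gamma> 0 = (\<lambda>J. koszul_f f (\<eta> 0) J + koszul_y (\<eta> (Suc 0)) J)" using \<eta>(2)[of 0] by auto
    then have "koszul_y (?\<gamma> 0) = (\<lambda>J. - koszul_f f (koszul_y (\<eta> 0)) J)"
      by (simp add: koszul_map_add koszul_map_square)
         (simp add: fun_eq_iff koszul_map_anticommute[of "\<lambda>j. Var (Inr j)" "\<lambda>j. to_S (f j)"])
    then show "F_map (Suc (Suc (Suc i))) (F_part v) r =
        (- 1) ^ Suc i * \<nu>_map (Suc (Suc i)) (koszul_f f (koszul_y (\<lambda>J. - \<eta> 0 J))) r"
      using F[OF r] by (simp add: koszul_map_uminus \<nu>_map_linear)
  next
    fix b
    show "(\<lambda>J. - \<eta> b J) \<in> wedge (Suc i + 3)" using \<eta>(1)[of b] by (simp add: wedge_def eval_nat_numeral)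
  qed
qed

lemma res_exact:
  "{v \<in> free_mod (gens R (Suc i)). differential R (Suc i) v = (\<lambda>_. 0)}
    = differential R (Suc (Suc i)) ` free_mod (gens R (Suc (Suc i)))"
proof (intro equalityI subsetI)
  fix v assume "v \<in> {v \<in> free_mod (gens R (Suc i)). differential R (Suc i) v = (\<lambda>_. 0)}"
  then show "v \<in> differential R (Suc (Suc i)) ` free_mod (gens R (Suc (Suc i)))"
    by (cases i) (auto intro: res_exact_0 res_exact_Suc)
next
  fix v assume "v \<in> differential R (Suc (Suc i)) ` free_mod (gens R (Suc (Suc i)))"
  then show "v \<in> {v \<in> free_mod (gens R (Suc i)). differential R (Suc i) v = (\<lambda>_. 0)}"
    using res_complex differential_outside by (auto simp: free_mod_def)
qed

end

section \<open>Degrees and minimality\<close>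

lemma (in monomial_grading) homogeneous_koszul:
  fixes z :: "'y::linorder \<Rightarrow> ('v, 'k::comm_ring_1) mpoly"
  assumes "\<And>j. j \<in> J \<Longrightarrow> J' = J - {j} \<Longrightarrow> homogeneous deg (z j) a"
  shows "homogeneous deg (koszul z J' J) a"
  unfolding koszul_def
  by (intro homogeneous_sum) (auto intro: homogeneous_sign_mult homogeneous_0 assms)

lemma koszul_in_ideal:
  assumes "\<And>j. z j \<in> ideal X"
  shows "koszul z J' J \<in> ideal X"
  unfolding koszul_def by (intro ideal.span_sum) (auto intro: ideal.span_scale ideal.span_zero assms)

lemma sum_remove_diff:
  fixes h :: "'y \<Rightarrow> int"
  assumes "finite J" "j \<in> J"
  shows "h j = sum h J - sum h (J - {j})"
  using sum.remove[OF assms, of h] by simp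

context rees_exact
begin

lemma br_alpha_homogeneous:
  assumes "r \<in> gens F (Suc i)" "card J = Suc (Suc i)"
  shows "homogeneous (bideg d) (br_alpha \<nu> i r (J, a, b)) ((\<Sum>j\<in>J. int (d j)) - gdeg F (Suc i) r, int b + 1)"
proof (cases "b = 0")
  case True
  have "homogeneous (bideg d) (to_S (\<nu> (Suc i) r J') * koszul (\<lambda>j. Var (Inr j)) J' J)
      ((\<Sum>j\<in>J. int (d j)) - gdeg F (Suc i) r, 1)" if "card J' = Suc i" for J'
  proof -
    have "\<forall>m\<in>Poly_Mapping.keys (\<nu> (Suc i) r J'). std_deg m + gdeg F (Suc i) r = (\<Sum>j\<in>J'. int (d j))"
      using comparison assms(1) that unfolding koszul_comparison_def by blast
    then have "homogeneous std_deg (\<nu> (Suc i) r J') ((\<Sum>j\<in>J'. int (d j)) - gdeg F (Suc i) r)"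
      by (auto simp: homogeneous_def)
    note nu = homogeneous_to_S[OF this, of d]
    have "homogeneous (bideg d) (koszul (\<lambda>j. Var (Inr j)) J' J) ((\<Sum>j\<in>J. int (d j)) - (\<Sum>j\<in>J'. int (d j)), 1)"
      proof (rule bi.homogeneous_koszul)
        fix j assume "j \<in> J" "J' = J - {j}"
        then have "(\<Sum>j\<in>J. int (d j)) - (\<Sum>j\<in>J'. int (d j)) = int (d j)"
          using sum_remove_diff[of J j "\<lambda>j. int (d j)"] by simp
        then show "homogeneous (bideg d) (Var (Inr j)) ((\<Sum>j\<in>J. int (d j)) - (\<Sum>j\<in>J'. int (d j)), 1)"
          by (simp add: bideg_Var_Inr)
      qed
    from bi.homogeneous_mult[OF nu this] show ?thesis by simp
  qed
  then show ?thesis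
    using True by (auto simp: br_alpha_def intro!: bi.homogeneous_sign_mult bi.homogeneous_sum)
next
  case False
  then show ?thesis by (simp add: br_alpha_def bi.homogeneous_0)
qed

lemma br_sigma_homogeneous:
  "homogeneous (bideg d) (br_sigma f (J', a', b') (J, a, b))
    ((\<Sum>j\<in>J. int (d j)) - (\<Sum>j\<in>J'. int (d j)), int b - int b')"
proof -
  have f: "homogeneous (bideg d) (koszul (\<lambda>j. to_S (f j)) J' J) ((\<Sum>j\<in>J. int (d j)) - (\<Sum>j\<in>J'. int (d j)), 0)"
    proof (rule bi.homogeneous_koszul)
      fix j assume "j \<in> J" "J' = J - {j}"
      then have "(\<Sum>j\<in>J. int (d j)) - (\<Sum>j\<in>J'. int (d j)) = int (d j)"
        using sum_remove_diff[of J j "\<lambda>j. int (d j)"] by simp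
      then show "homogeneous (bideg d) (to_S (f j)) ((\<Sum>j\<in>J. int (d j)) - (\<Sum>j\<in>J'. int (d j)), 0)"
        by (simp add: homogeneous_to_S hom_f)
    qed
  have y: "homogeneous (bideg d) (koszul (\<lambda>j. Var (Inr j)) J' J) ((\<Sum>j\<in>J. int (d j)) - (\<Sum>j\<in>J'. int (d j)), 1)"
    proof (rule bi.homogeneous_koszul)
      fix j assume "j \<in> J" "J' = J - {j}"
      then have "(\<Sum>j\<in>J. int (d j)) - (\<Sum>j\<in>J'. int (d j)) = int (d j)"
        using sum_remove_diff[of J j "\<lambda>j. int (d j)"] by simp
      then show "homogeneous (bideg d) (Var (Inr j)) ((\<Sum>j\<in>J. int (d j)) - (\<Sum>j\<in>J'. int (d j)), 1)"
        by (simp add: bideg_Var_Inr)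
    qed
  show ?thesis
    unfolding br_sigma_def using f y
    by (auto intro!: bi.homogeneous_add simp: bi.homogeneous_0)
qed

lemma res_homogeneous:
  assumes "r \<in> gens R i" "s \<in> gens R (Suc i)"
  shows "homogeneous (bideg d) (dmat R (Suc i) r s) (gdeg R (Suc i) s - gdeg R i r)"
proof (cases i)
  case 0
  then have r: "r = One" using assms(1) gens_R_0 by simp
  obtain s' where s: "s = FGen s'" "s' \<in> gens F (Suc (Suc 0))"
    using assms(2) unfolding 0 by (cases rule: gens_R_cases) auto
  have "homogeneous (bideg d) (Var (Inr j) * to_S (dmat F 2 (e j) s')) (gdeg F 2 s', 1)" for j
  proof -
    have "homogeneous std_deg (dmat F (Suc 1) (e j) s') (gdeg F (Suc 1) s' - gdeg F 1 (e j))"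
      by (rule F_graded) (use s F_1 in auto)
    from bi.homogeneous_mult[OF bideg_Var_Inr[of d j] homogeneous_to_S[OF this, of d]]
    show ?thesis using F_1_deg by (simp add: numeral_2_eq_2)
  qed
  then have "homogeneous (bideg d) (\<Sum>j\<in>UNIV. Var (Inr j) * to_S (dmat F 2 (e j) s')) (gdeg F 2 s', 1)"
    by (intro bi.homogeneous_sum)
  then show ?thesis using 0 r s by (simp add: rees_resolution_def res_delta_def numeral_2_eq_2)
next
  case (Suc i')
  from assms(1)[unfolded Suc] show ?thesis
  proof (cases rule: gens_R_cases)
    case r: (F r')
    from assms(2) show ?thesis
    proof (cases rule: gens_R_cases)
      case s: (F s')
      have "homogeneous std_deg (dmat F (Suc (Suc i)) r' s') (gdeg F (Suc (Suc i)) s' - gdeg F (Suc i) r')"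
        by (rule F_graded) (use r s Suc in auto)
      from homogeneous_to_S[OF this, of d] show ?thesis
        using r s by (simp add: rees_resolution_def res_delta_def)
    next
      case s: (C J b)
      show ?thesis using br_alpha_homogeneous[of r' i J "i - 1 - b" b] r s Suc
        by (simp add: rees_resolution_def res_delta_def br_deg_def add.commute)
    qed
  next
    case r: (C J' b')
    from assms(2) show ?thesis
    proof (cases rule: gens_R_cases)
      case s: (F s')
      show ?thesis using r s by (simp add: rees_resolution_def res_delta_def bi.homogeneous_0)
    next
      case s: (C J b)
      show ?thesis
        using bi.homogeneous_uminus[OF br_sigma_homogeneous[of J' "i' - 1 - b'" b' J "i - 1 - b" b]] r s
        by (simp add: rees_resolution_def res_delta_def br_deg_def)
    qed
  qed
qed

lemma res_minimal:
  assumes "r \<in> gens R i" "s \<in> gens R (Suc i)"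
  shows "dmat R (Suc i) r s \<in> ideal (range Var)"
proof -
  have y: "koszul (\<lambda>j. Var (Inr j)) J' J \<in> ideal (range (Var :: _ \<Rightarrow> ('x + 'y, 'k) mpoly))" for J' J :: "'y set"
    by (intro koszul_in_ideal ideal.span_base) simp
  have "f j \<in> ideal (range Var)" for j
    using F_minimal[of u 0 "e j"] F_0 F_1 F_1_dmat by simp
  then have f: "koszul (\<lambda>j. to_S (f j)) J' J \<in> ideal (range (Var :: _ \<Rightarrow> ('x + 'y, 'k) mpoly))" for J' J :: "'y set"
    by (intro koszul_in_ideal to_S_in_ideal_Var)
  have alpha: "br_alpha \<nu> i r' c \<in> ideal (range (Var :: _ \<Rightarrow> ('x + 'y, 'k) mpoly))" for i r' c
    unfolding br_alpha_def
    by (auto split: prod.split intro!: ideal.span_scale ideal.span_sum y simp: ideal.span_zero)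
  have sigma: "- br_sigma f c' c \<in> ideal (range (Var :: _ \<Rightarrow> ('x + 'y, 'k) mpoly))" for c' c
    unfolding br_sigma_def
    by (intro ideal.span_neg) (auto split: prod.split intro!: ideal.span_add y f simp: ideal.span_zero)
  show ?thesis
  proof (cases i)
    case 0
    then have r: "r = One" using assms(1) gens_R_0 by simp
    obtain s' where s: "s = FGen s'"
      using assms(2) unfolding 0 by (cases rule: gens_R_cases) auto
    have "(\<Sum>j\<in>UNIV. Var (Inr j) * to_S (dmat F 2 (e j) s')) \<in> ideal (range (Var :: _ \<Rightarrow> ('x + 'y, 'k) mpoly))"
      by (intro ideal.span_sum ideal_mult_right ideal.span_base) simp
    then show ?thesis using r s by (simp add: rees_resolution_def res_delta_def)
  next
    case (Suc i')
    have F: "to_S (dmat F (Suc (Suc i)) r' s') \<in> ideal (range (Var :: _ \<Rightarrow> ('x + 'y, 'k) mpoly))"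
      if "r' \<in> gens F (Suc (Suc i'))" "s' \<in> gens F (Suc (Suc i))" for r' s'
      using F_minimal[of r' "Suc i" s'] that Suc by (intro to_S_in_ideal_Var) simp
    from assms(1)[unfolded Suc] assms(2) show ?thesis
      by (elim gens_R_cases)
         (auto simp: rees_resolution_def res_delta_def ideal.span_zero intro!: F alpha sigma)
  qed
qed

text \<open>Each column of a differential has a nonzero entry: otherwise a basis vector would be a cycle,
  hence a boundary, and by minimality \<open>1\<close> would lie in the ideal of the variables. As this entry has
  positive degree, the degrees of the basis elements increase strictly from one step to the next.\<close>

lemma resolution_degree_bound:
  assumes "gdeg F 0 u = 0" "s \<in> gens F i"
  shows "int i \<le> gdeg F i s"
  using assms(2)
proof (induction i arbitrary: s)
  case 0
  then show ?case using F_0 assms(1) by simp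
next
  case (Suc i)
  have "\<exists>r\<in>gens F i. dmat F (Suc i) r s \<noteq> 0"
  proof (rule ccontr)
    assume "\<not> ?thesis"
    then have zero: "dmat F (Suc i) r s = 0" if "r \<in> gens F i" for r using that by auto
    define v where "v s' = (if s' = s then 1 else 0 :: ('x, 'k) mpoly)" for s'
    have "\<exists>w. \<forall>s'\<in>gens F (Suc i). v s' = (\<Sum>t\<in>gens F (Suc (Suc i)). dmat F (Suc (Suc i)) s' t * w t)"
      by (rule F_exact_B) (auto simp: v_def zero intro!: sum.neutral)
    then obtain w where "1 = (\<Sum>t\<in>gens F (Suc (Suc i)). dmat F (Suc (Suc i)) s t * w t)"
      using Suc.prems by (auto simp: v_def)
    moreover have "\<dots> \<in> ideal (range Var)"
      using Suc.prems by (intro ideal.span_sum ideal_mult_right F_minimal)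
    ultimately have "(1 :: ('x, 'k) mpoly) \<in> ideal (range Var)" by simp
    then show False by (simp add: ideal_Var)
  qed
  then obtain r where r: "r \<in> gens F i" "dmat F (Suc i) r s \<noteq> 0" by auto
  then obtain m where m: "m \<in> Poly_Mapping.keys (dmat F (Suc i) r s)"
    by (auto simp: poly_mapping_eq_iff fun_eq_iff in_keys_iff)
  obtain v where "Poly_Mapping.lookup m v \<noteq> 0"
    using F_minimal[OF r(1) Suc.prems] m by (auto simp: ideal_Var)
  then have "1 \<le> std_deg m"
    using member_le_sum[of v UNIV "\<lambda>v. int (Poly_Mapping.lookup m v)"] by (simp add: std_deg_def)
  moreover have "std_deg m = gdeg F (Suc i) s - gdeg F i r"
    using F_graded[OF r(1) Suc.prems] m by (simp add: homogeneous_def)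
  ultimately show ?case using Suc.IH[OF r(1)] by simp
qed

section \<open>The augmentation\<close>


text \<open>The coefficients of a linear syzygy form a cycle in \<open>F\<^sub>1\<close>, hence lie in the image of \<open>\<phi>\<^sub>2\<close>.\<close>

lemma kernel_augmentation:
  assumes lt: "linear_type I" and x: "rees_map f x = 0"
  shows "\<exists>V. x = (\<Sum>j\<in>UNIV. Var (Inr j) * F_map 2 V (e j))"
  using kernel_rees_map[OF lt x]
proof (induction rule: ideal.span_induct_alt)
  case base
  show ?case by (rule exI[of _ "\<lambda>_. 0"]) (simp add: F_map_def)
next
  case (step c x y)
  then obtain w V where w: "x = linear_form w" "(\<Sum>j\<in>UNIV. w j * f j) = 0"
    and y: "y = (\<Sum>j\<in>UNIV. Var (Inr j) * F_map 2 V (e j))"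
    by (auto simp: linear_syzygies_def)
  have "\<exists>b. \<forall>s\<in>gens F (Suc 0). w (inv e s) = (\<Sum>t\<in>gens F (Suc (Suc 0)). dmat F (Suc (Suc 0)) s t * b t)"
  proof (rule F_exact_B)
    fix r assume "r \<in> gens F 0"
    then show "(\<Sum>s\<in>gens F (Suc 0). dmat F (Suc 0) r s * w (inv e s)) = 0"
      using w(2) F_0 F_1_dmat inj_e by (simp add: sum_F_1[unfolded One_nat_def] mult.commute)
  qed
  then obtain b where b: "w j = (\<Sum>t\<in>gens F 2. dmat F 2 (e j) t * b t)" for j
    using F_1 inj_e by (force simp: numeral_2_eq_2)
  have "x = (\<Sum>j\<in>UNIV. Var (Inr j) * F_map 2 (\<lambda>s. to_S (b s)) (e j))"
    by (simp add: w(1) linear_form_def b to_S_simps F_map_def)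
  then have "c * x + y = (\<Sum>j\<in>UNIV. Var (Inr j) * F_map 2 (\<lambda>s. c * to_S (b s) + V s) (e j))"
    by (simp add: y F_map_linear distrib_left sum.distrib sum_distrib_left mult.left_commute)
  then show ?case by (rule exI[of _ "\<lambda>s. c * to_S (b s) + V s"])
qed

lemma rees_map_image_0: "rees_map f (\<Sum>j\<in>UNIV. Var (Inr j) * F_map 2 V (e j)) = 0"
proof -
  have "(\<Sum>j\<in>UNIV. Var (Inr j) * F_map 2 V (e j)) =
      (\<Sum>s\<in>gens F 2. linear_form (\<lambda>j. dmat F 2 (e j) s) * V s)"
    unfolding F_map_def linear_form_def sum_distrib_left sum_distrib_right
    by (subst sum.swap) (simp add: mult.assoc)
  moreover have "(\<Sum>j\<in>UNIV. dmat F 2 (e j) s * f j) = 0" if "s \<in> gens F 2" for s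
    using F_complex[of u 0 s] that F_0 F_1_dmat
    by (simp add: sum_F_1[unfolded One_nat_def] numeral_2_eq_2 mult.commute)
  ultimately show ?thesis by (simp add: rees_map_simps rees_map_linear_form)
qed

lemma augmentation_kernel_iff:
  assumes lt: "linear_type I" and v: "v \<in> free_mod (gens R 0)" "w \<in> free_mod (gens R 0)"
  shows "rees_map f (v One) = rees_map f (w One) \<longleftrightarrow>
    (\<lambda>b. v b - w b) \<in> differential R 1 ` free_mod (gens R 1)"
proof
  assume "rees_map f (v One) = rees_map f (w One)"
  then have "rees_map f (v One - w One) = 0" by (simp add: rees_map_simps)
  then obtain V where V: "v One - w One = (\<Sum>j\<in>UNIV. Var (Inr j) * F_map 2 V (e j))"
    using kernel_augmentation[OF lt] by blast
  let ?x = "res_vector (Suc 0) V (\<lambda>_ _. 0)"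
  have x: "?x \<in> free_mod (gens R (Suc 0))" by (rule res_vector_free_mod)
  have "v b - w b = differential R (Suc 0) ?x b" for b
  proof (cases "b = One")
    case True
    have "F_map 2 (F_part ?x) r = F_map 2 V r" for r
      by (rule F_map_cong) (simp add: F_part_res_vector numeral_2_eq_2)
    with True V show ?thesis by (simp add: differential_One)
  next
    case False
    then show ?thesis using v differential_outside[of b 0 ?x] gens_R_0 by (simp add: free_mod_def)
  qed
  then show "(\<lambda>b. v b - w b) \<in> differential R 1 ` free_mod (gens R 1)"
    using x by auto
next
  assume "(\<lambda>b. v b - w b) \<in> differential R 1 ` free_mod (gens R 1)"
  then obtain x where "(\<lambda>b. v b - w b) = differential R (Suc 0) x" by auto
  then have "v One - w One = differential R (Suc 0) x One" by (rule fun_cong)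
  then have "rees_map f (v One - w One) = 0" by (simp only: differential_One rees_map_image_0)
  then show "rees_map f (v One) = rees_map f (w One)" by (simp add: rees_map_simps)
qed

theorem rees_resolution_minimal:
  assumes lt: "linear_type I"
  shows "min_graded_free_resolution (bideg d) R (rees_module f) (\<lambda>v. rees_map f (v One))"
  unfolding min_graded_free_resolution_def
proof (intro conjI allI ballI)
  fix i
  show "finite (gens R i)"
    using F_finite finite_br_gens by (simp add: rees_resolution_def res_gens_def)
next
  fix i r s m
  assume "r \<in> gens R i" "s \<in> gens R (Suc i)" "m \<in> Poly_Mapping.keys (dmat R (Suc i) r s)"
  then show "bideg d m + gdeg R i r = gdeg R (Suc i) s"
    using res_homogeneous by (simp add: homogeneous_def)
next
  show "{v \<in> free_mod (gens R (Suc i)). differential R (Suc i) v = (\<lambda>_. 0)}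
      = differential R (Suc (Suc i)) ` free_mod (gens R (Suc (Suc i)))" for i
    by (rule res_exact)
next
  show "rees_map f (r * v One) = mscale (rees_module f) r (rees_map f (v One))"
    for r and v :: "('y, 'b) res_gen \<Rightarrow> ('x + 'y, 'k) mpoly"
    by (simp add: rees_module_def Let_def rees_map_simps)
next
  fix b assume "b \<in> gens R 0"
  then have "b = One" using gens_R_0 by simp
  moreover have "1 \<in> mcomponent (rees_module f) (0, 0)"
    using std.homogeneous_1
    by (auto simp: rees_module_def Let_def intro!: exI[of _ 1] exI[of _ "0 :: nat"])
  ultimately show "rees_map f (if One = b then 1 else 0) \<in> mcomponent (rees_module f) (gdeg R 0 b)"
    by (simp add: rees_map_simps) (simp add: rees_resolution_def)
next
  have "(\<lambda>v. rees_map f (v One)) ` free_mod (gens R 0) = range (rees_map f)"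
  proof (intro equalityI subsetI)
    fix p assume "p \<in> range (rees_map f)"
    then obtain s where "p = rees_map f s" by auto
    moreover have "(\<lambda>b. if b = One then s else 0) \<in> free_mod (gens R 0)"
      by (simp add: gens_R_0 free_mod_def)
    ultimately show "p \<in> (\<lambda>v. rees_map f (v One)) ` free_mod (gens R 0)"
      by (intro rev_image_eqI[where x = "\<lambda>b. if b = One then s else 0"]) simp_all
  qed auto
  then show "(\<lambda>v. rees_map f (v One)) ` free_mod (gens R 0) = mcarrier (rees_module f)"
    using range_rees_map[OF lt] by (simp add: rees_module_def Let_def I_def)
next
  fix v w :: "('y, 'b) res_gen \<Rightarrow> ('x + 'y, 'k) mpoly"
  show "rees_map f (v One + w One) = rees_map f (v One) + rees_map f (w One)"
    by (simp add: rees_map_simps)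
  assume "v \<in> free_mod (gens R 0)" "w \<in> free_mod (gens R 0)"
  then show "rees_map f (v One) = rees_map f (w One) \<longleftrightarrow>
      (\<lambda>b. v b - w b) \<in> differential R 1 ` free_mod (gens R 1)"
    by (rule augmentation_kernel_iff[OF lt])
next
  show "dmat R (Suc i) r s \<in> ideal (range Var)" if "r \<in> gens R i" "s \<in> gens R (Suc i)" for i r s
    using that by (rule res_minimal)
qed

end

section \<open>The minimal resolution of the Rees algebra\<close>

text \<open>A finite supremum of extended naturals over a nonempty set is a maximum.\<close>

lemma grade_attained:
  fixes I :: "('v, 'k::comm_ring_1) mpoly set"
  assumes "grade I = enat n"
  obtains rs where "weakly_regular rs" "length rs = n" "set rs \<subseteq> I"
proof -
  let ?L = "{enat (length rs) | rs. regular_sequence rs \<and> set rs \<subseteq> I}"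
  have sup: "Sup ?L = enat n" using assms by (auto simp: grade_def split: if_splits)
  have "regular_sequence ([] :: ('v, 'k) mpoly list)"
    using one_neq_zero[where 'a = "('v, 'k) mpoly"] by (auto simp: regular_sequence_def simp del: one_neq_zero)
  then have "?L \<noteq> {}" by force
  then have "enat n \<in> ?L"
    using sup Max_in[of ?L] by (auto simp: Sup_enat_def split: if_splits)
  then show thesis using that by (auto simp: regular_sequence_def weakly_regular_def)
qed

theorem theorem3p1:
  fixes f :: "'y::{finite,linorder} \<Rightarrow> ('x::{finite,linorder}, 'k::field_char_0) mpoly"
    and d :: "'y \<Rightarrow> nat"
    and n :: nat
    and I :: "('x, 'k) mpoly set"
    and F :: "('b, ('x, 'k) mpoly, int) free_complex"
    and u :: 'b
    and e :: "'y \<Rightarrow> 'b"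
    and \<nu> :: "nat \<Rightarrow> 'b \<Rightarrow> 'y set \<Rightarrow> ('x, 'k) mpoly"
  assumes number_of_generators: "CARD('y) = n + 1"
    and homogeneous_generators: "\<And>j. homogeneous std_deg (f j) (int (d j))"
    and I_def: "I = ideal (range f)"
    and minimal_generators: "\<And>j. f j \<notin> ideal (f ` (UNIV - {j}))"
    and grade_I: "grade I = enat n"
    and linear_type_I: "linear_type I"
    and F_resolution:
      "min_graded_free_resolution std_deg F (quotient_module I) (\<lambda>v. v u +o I)"
    and F_0: "gens F 0 = {u}" "gdeg F 0 u = 0"
    and F_1: "inj e" "gens F 1 = range e"
      "\<And>j. gdeg F 1 (e j) = int (d j)" "\<And>j. dmat F 1 u (e j) = f j"
    and comparison: "koszul_comparison f d F u e \<nu>"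
  shows "min_graded_free_resolution (bideg d) (rees_resolution f d F e \<nu>) (rees_module f)
           (\<lambda>v. rees_map f (v One))
       \<and> (\<forall>i\<ge>2. \<forall>j. betti F i j \<noteq> 0 \<longrightarrow> int i \<le> j)"
proof -
  obtain rs where rs: "weakly_regular rs" "length rs = n" "set rs \<subseteq> ideal (range f)"
    using grade_attained[OF grade_I] unfolding I_def by blast
  have "inj f"
  proof (rule injI, rule ccontr)
    fix i j assume "f i = f j" "i \<noteq> j"
    then have "f i \<in> ideal (f ` (UNIV - {i}))" by (auto intro: ideal.span_base)
    then show False using minimal_generators by blast
  qed
  note res = F_resolution[unfolded min_graded_free_resolution_def]
  note graded = res[THEN conjunct2, THEN conjunct1, rule_format]
  interpret rees_exact f I d F u e \<nu>
  proof unfold_locales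
    show "\<exists>\<eta>\<in>wedge (Suc (Suc (Suc k))). \<gamma> = koszul_f f \<eta>"
      if "\<gamma> \<in> wedge (Suc (Suc k))" "koszul_f f \<gamma> = (\<lambda>J. 0)" for k \<gamma>
      using rs number_of_generators that by (intro koszul_f_exact[of rs]) auto
    show "homogeneous std_deg (dmat F (Suc i) r s) (gdeg F (Suc i) s - gdeg F i r)"
      if "r \<in> gens F i" "s \<in> gens F (Suc i)" for i r s
      using graded[OF that] by (force simp: homogeneous_def)
  qed (use assms res \<open>inj f\<close> in \<open>simp_all\<close>)
  have "int i \<le> j" if "betti F i j \<noteq> 0" for i j
  proof -
    have "{b \<in> gens F i. gdeg F i b = j} \<noteq> {}"
      using that unfolding betti_def by (metis card.empty)
    then show ?thesis using resolution_degree_bound[OF \<open>gdeg F 0 u = 0\<close>] by auto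
  qed
  then show ?thesis using rees_resolution_minimal[OF linear_type_I] by blast
qed

end
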